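(* Let $p(\vec x|\vec a)=\delta_{\vec x,f(\vec a)}$ be a deterministic $N$-party correlation, with $f=(f_1,\dots,f_N)$, $f_k:\vec A\to X_k$. Then $p$ is a quantum process correlation (i.e. admits a process-matrix realization) if and only if it admits a faithful process-function realization, meaning that both of the following hold: 1. There exist finite sets $B_k$ and functions $g_k:\vec A_{\backslash k}\to B_k$ ($k\in[N]$), with $B_k=\{g_k(\vec a_{\backslash k}):\vec a_{\backslash k}\in\vec A_{\backslash k}\}$, such that the map $g:\vec A\to\vec B:=B_1\times\dots\times B_N$, $g(\vec a)=(g_1(\vec a_{\backslash 1}),\dots,g_N(\vec a_{\backslash N}))$, is a process function (with output sets $A_k$ and input sets $B_k$), and there exist functions $f'_k:A_k\times B_k\to X_k$ with $f_k(\vec a)=f'_k(a_k,g_k(\vec a_{\backslash k}))$ for all $k$ and all $\vec a$. 2. (Faithfulness) For all $k\in[N]$ and all $\vec a_{\backslash k},\vec a'_{\backslash k}\in\vec A_{\backslash k}$: $g_k(\vec a_{\backslash k})\neq g_k(\vec a'_{\backslash k})$ if and only if there exists $a_k\in A_k$ with $f_k(a_k,\vec a_{\backslash k})\neq f_k(a_k,\vec a'_{\backslash k})$.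
   Context: Correlational scenario: parties $S_1,\dots,S_N$; party $S_k$ has a finite setting set $A_k$ and finite outcome set $X_k$; $\vec A=A_1\times\dots\times A_N$, $\vec X=X_1\times\dots\times X_N$; a correlation is a conditional probability distribution $p(\vec x|\vec a)$. $\vec a_{\backslash k}$ denotes $\vec a$ with the $k$-th entry removed, $\vec A_{\backslash k}$ the corresponding product set, and $[N]=\{1,\dots,N\}$. Process matrix framework: party $S_k$ has finite-dimensional input and output Hilbert spaces $\mathcal H^{I_k},\mathcal H^{O_k}$. The Choi–Jamiołkowski (CJ) matrix of a CP map $\mathcal M:\mathcal L(\mathcal H^{I})\to\mathcal L(\mathcal H^{O})$ is $M=[(\mathcal I\otimes\mathcal M)(\sum_{j,j'}|j\rangle\langle j'|\otimes|j\rangle\langle j'|)]^{T}\in\mathcal L(\mathcal H^{I}\otimes\mathcal H^{O})$. For each setting $a_k$, party $S_k$ performs a quantum instrument $\{\mathcal M_{x_k|a_k}\}_{x_k\in X_k}$ (CP maps summing to a CPTP map), with CJ matrices $M^{I_kO_k}_{x_k|a_k}$. A process matrix is $W\ge 0$ on $\bigotimes_k(\mathcal H^{I_k}\otimes\mathcal H^{O_k})$ with $\mathrm{Tr}(W\bigotimes_k M_k)=1$ for every choice of CJ matrices $M_k$ of CPTP maps $\mathcal L(\mathcal H^{I_k})\to\mathcal L(\mathcal H^{O_k})$. A correlation is a quantum process correlation if $p(\vec x|\vec a)=\mathrm{Tr}(W\bigotimes_k M^{I_kO_k}_{x_k|a_k})$ for some finite dimensions, process matrix and instruments. Classical processes: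 given finite sets $I_k,O_k$, a classical quasi-process is any conditional distribution $p(\vec i|\vec o)$. It is a classical process if for every choice of finite sets $A_k,X_k$ and local interventions $p(x_k,o_k|a_k,i_k)$, the expression $\sum_{\vec i,\vec o}\prod_k p(x_k,o_k|a_k,i_k)\,p(\vec i|\vec o)$ is a valid conditional probability distribution over $\vec x$ (nonnegative and summing to 1) for every $\vec a$. A function $\omega:\vec O\to\vec I$ is a process function if $\delta_{\vec i,\omega(\vec o)}$ is a classical process; equivalently, for every tuple $h=(h_k:I_k\to O_k)_k$ the map $\omega\circ h:\vec I\to\vec I$ has a unique fixed point. *)

theory Defs
  imports Complex_Main "HOL-Library.Complex_Order" "HOL-Library.FuncSet"
begin

text \<open>Parties are indexed by 0..N-1 (i.e. the set {..<N}).  Tuples of settings/outcomes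
  are extensional functions in PiE {..<N} A.  Operators on a finite-dimensional Hilbert space
  with orthonormal basis indexed by a finite set S are represented by their matrix entries
  M :: S => S => complex (entries outside S are irrelevant).  The space C^d has basis {..<d}.\<close>

type_synonym 'b cmat = "'b \<Rightarrow> 'b \<Rightarrow> complex"

definition psd_on :: "'b set \<Rightarrow> 'b cmat \<Rightarrow> bool" where
  "psd_on S M \<longleftrightarrow> (\<forall>\<psi> :: 'b \<Rightarrow> complex. 0 \<le> (\<Sum>u\<in>S. \<Sum>v\<in>S. cnj (\<psi> u) * M u v * \<psi> v))"

definition mats :: "nat \<Rightarrow> nat cmat set" where
  "mats d = {M. \<forall>i j. \<not> (i < d \<and> j < d) \<longrightarrow> M i j = 0}"

definition mtrace :: "nat \<Rightarrow> nat cmat \<Rightarrow> complex" where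
  "mtrace d M = (\<Sum>i<d. M i i)"

definition linear_map :: "nat \<Rightarrow> nat \<Rightarrow> (nat cmat \<Rightarrow> nat cmat) \<Rightarrow> bool" where
  "linear_map dI dO \<Phi> \<longleftrightarrow>
     (\<forall>M\<in>mats dI. \<Phi> M \<in> mats dO) \<and>
     (\<forall>M\<in>mats dI. \<forall>M'\<in>mats dI. \<forall>c. \<Phi> (\<lambda>i j. c * M i j + M' i j) = (\<lambda>i j. c * \<Phi> M i j + \<Phi> M' i j))"

text \<open>(id_n tensor Phi) acting on L(C^n tensor C^dI), basis {..<n} x {..<dI}.\<close>
definition ampl :: "nat \<Rightarrow> (nat cmat \<Rightarrow> nat cmat) \<Rightarrow> (nat \<times> nat) cmat \<Rightarrow> (nat \<times> nat) cmat" where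
  "ampl dI \<Phi> Y = (\<lambda>(a, r) (b, r'). \<Phi> (\<lambda>i j. if i < dI \<and> j < dI then Y (a, i) (b, j) else 0) r r')"

definition completely_positive :: "nat \<Rightarrow> nat \<Rightarrow> (nat cmat \<Rightarrow> nat cmat) \<Rightarrow> bool" where
  "completely_positive dI dO \<Phi> \<longleftrightarrow> linear_map dI dO \<Phi> \<and>
     (\<forall>n Y. psd_on ({..<n} \<times> {..<dI}) Y \<longrightarrow> psd_on ({..<n} \<times> {..<dO}) (ampl dI \<Phi> Y))"

definition trace_preserving :: "nat \<Rightarrow> nat \<Rightarrow> (nat cmat \<Rightarrow> nat cmat) \<Rightarrow> bool" where
  "trace_preserving dI dO \<Phi> \<longleftrightarrow> (\<forall>M\<in>mats dI. mtrace dO (\<Phi> M) = mtrace dI M)"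

definition cptp :: "nat \<Rightarrow> nat \<Rightarrow> (nat cmat \<Rightarrow> nat cmat) \<Rightarrow> bool" where
  "cptp dI dO \<Phi> \<longleftrightarrow> completely_positive dI dO \<Phi> \<and> trace_preserving dI dO \<Phi>"

definition munit :: "nat \<Rightarrow> nat \<Rightarrow> nat cmat" where
  "munit a b = (\<lambda>i j. if i = a \<and> j = b then 1 else 0)"

text \<open>Choi-Jamiolkowski matrix  M = [(I tensor Phi)(sum_{j,j'} |j><j'| tensor |j><j'|)]^T
  on H^I tensor H^O, basis {..<dI} x {..<dO}:  M((j,o),(j',o')) = Phi(|j'><j|)(o',o).\<close>
definition cj :: "(nat cmat \<Rightarrow> nat cmat) \<Rightarrow> (nat \<times> nat) cmat" where
  "cj \<Phi> = (\<lambda>(j, r) (j', r'). \<Phi> (munit j' j) r' r)"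

definition instrument :: "nat \<Rightarrow> nat \<Rightarrow> 'x set \<Rightarrow> ('x \<Rightarrow> nat cmat \<Rightarrow> nat cmat) \<Rightarrow> bool" where
  "instrument dI dO Xk \<Psi> \<longleftrightarrow> (\<forall>x\<in>Xk. completely_positive dI dO (\<Psi> x)) \<and>
     cptp dI dO (\<lambda>M i j. \<Sum>x\<in>Xk. \<Psi> x M i j)"

text \<open>Basis of the joint space  tensor_k (H^{I_k} tensor H^{O_k}).\<close>
definition pm_basis :: "nat \<Rightarrow> (nat \<Rightarrow> nat) \<Rightarrow> (nat \<Rightarrow> nat) \<Rightarrow> (nat \<Rightarrow> nat \<times> nat) set" where
  "pm_basis N dI dO = PiE {..<N} (\<lambda>k. {..<dI k} \<times> {..<dO k})"

text \<open>Tr(W (M_1 tensor ... tensor M_N)).\<close>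
definition tr_prod :: "nat \<Rightarrow> (nat \<Rightarrow> nat) \<Rightarrow> (nat \<Rightarrow> nat) \<Rightarrow> (nat \<Rightarrow> nat \<times> nat) cmat
     \<Rightarrow> (nat \<Rightarrow> (nat \<times> nat) cmat) \<Rightarrow> complex" where
  "tr_prod N dI dO W M = (\<Sum>u\<in>pm_basis N dI dO. \<Sum>v\<in>pm_basis N dI dO. W u v * (\<Prod>k<N. M k (v k) (u k)))"

definition process_matrix :: "nat \<Rightarrow> (nat \<Rightarrow> nat) \<Rightarrow> (nat \<Rightarrow> nat) \<Rightarrow> (nat \<Rightarrow> nat \<times> nat) cmat \<Rightarrow> bool" where
  "process_matrix N dI dO W \<longleftrightarrow> psd_on (pm_basis N dI dO) W \<and>
     (\<forall>\<Phi>. (\<forall>k<N. cptp (dI k) (dO k) (\<Phi> k)) \<longrightarrow> tr_prod N dI dO W (\<lambda>k. cj (\<Phi> k)) = 1)"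

definition quantum_process_correlation ::
  "nat \<Rightarrow> (nat \<Rightarrow> 'a set) \<Rightarrow> (nat \<Rightarrow> 'x set) \<Rightarrow> ((nat \<Rightarrow> 'a) \<Rightarrow> (nat \<Rightarrow> 'x) \<Rightarrow> real) \<Rightarrow> bool" where
  "quantum_process_correlation N A X p \<longleftrightarrow>
     (\<exists>dI dO W (\<Psi> :: nat \<Rightarrow> 'a \<Rightarrow> 'x \<Rightarrow> nat cmat \<Rightarrow> nat cmat).
        (\<forall>k<N. 0 < dI k \<and> 0 < dO k) \<and>
        process_matrix N dI dO W \<and>
        (\<forall>k<N. \<forall>a\<in>A k. instrument (dI k) (dO k) (X k) (\<Psi> k a)) \<and>
        (\<forall>a\<in>PiE {..<N} A. \<forall>x\<in>PiE {..<N} X.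
           complex_of_real (p a x) = tr_prod N dI dO W (\<lambda>k. cj (\<Psi> k (a k) (x k)))))"

text \<open>Process function omega : vec O -> vec I, via the unique-fixed-point characterization.\<close>
definition process_function ::
  "nat \<Rightarrow> (nat \<Rightarrow> 'o set) \<Rightarrow> (nat \<Rightarrow> 'i set) \<Rightarrow> ((nat \<Rightarrow> 'o) \<Rightarrow> (nat \<Rightarrow> 'i)) \<Rightarrow> bool" where
  "process_function N Os Is \<omega> \<longleftrightarrow>
     (\<forall>b\<in>PiE {..<N} Os. \<omega> b \<in> PiE {..<N} Is) \<and>
     (\<forall>h. (\<forall>k<N. \<forall>i\<in>Is k. h k i \<in> Os k) \<longrightarrow>
          (\<exists>!i. i \<in> PiE {..<N} Is \<and> \<omega> (\<lambda>k\<in>{..<N}. h k (i k)) = i))"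

definition drop_k :: "nat \<Rightarrow> nat \<Rightarrow> (nat \<Rightarrow> 'a) \<Rightarrow> (nat \<Rightarrow> 'a)" where
  "drop_k N k a = restrict a ({..<N} - {k})"

end

theory Submission
  imports Defs
begin

text \<open>A process function gives the diagonal process matrix supported on its graph; it is normalised
  because every tuple of stochastic local maps is a mixture of deterministic ones, each having exactly
  one fixed point.

  Conversely, let \<open>g k\<close> label the classes of settings of the others that party \<open>k\<close> can tell apart.
  When the others use settings \<open>a\<close>, the state that reaches party \<open>k\<close> lies in the common kernel of all
  effects excluded by the label \<open>g k a\<close>, and the kernels of distinct labels are orthogonal. So party
  \<open>k\<close> can measure its label projectively without changing any statistics; doing this for one party
  after another, all parties learn their labels jointly. For a tuple \<open>h\<close>, let every party measure its
  label \<open>b\<close> and then act as under setting \<open>h k b\<close>: outcome \<open>b\<close> has probability \<open>1\<close> if \<open>b\<close> is a fixed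
  point and \<open>0\<close> otherwise, so normalisation says that there is exactly one fixed point.\<close>

subsection \<open>Positive semidefinite matrices\<close>

text \<open>Normalisation constrains \<open>W\<close> only against products of channels, so it needs
  an argument that a state reaches party \<open>k\<close> at all. Once the other slots hold
  channels, two Choi matrices of party \<open>k\<close> with equal effects complete to channels by
  the same remainder, so their values agree. The value thus depends on the effect alone and is given
  by a positive matrix on the input space. Only in this form does "excluded outcomes have
  probability zero" become a statement about kernels. Orthogonality of labels alone does not make
  the measurement harmless: coherences between labels might contribute to the statistics. They
  vanish because the values of \<open>W\<close> on the blocks between labels form a positive matrix
  in which all diagonal entries but one are zero. The induction over measuring parties is stated for
  each joint outcome at fixed settings. The Choi matrix of a single outcome mentions one setting per
  party, so the setting may afterwards be chosen as a function of the label contained in the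
  outcome. This is how a statement about fixed settings yields one about arbitrary
  \<open>h\<close>.\<close>

lemma psd_onD: "psd_on S M \<Longrightarrow> 0 \<le> (\<Sum>u\<in>S. \<Sum>v\<in>S. cnj (\<psi> u) * M u v * \<psi> v)"
  by (auto simp: psd_on_def)

lemma psd_on_cong: "(\<And>u v. u \<in> S \<Longrightarrow> v \<in> S \<Longrightarrow> M u v = M' u v) \<Longrightarrow> psd_on S M = psd_on S M'"
  by (simp add: psd_on_def)

lemma psd_on_subset:
  assumes "psd_on S M" "T \<subseteq> S" "finite S"
  shows "psd_on T M"
  unfolding psd_on_def
proof
  fix \<psi> :: "'a \<Rightarrow> complex"
  define \<phi> where "\<phi> = (\<lambda>u. if u \<in> T then \<psi> u else 0)"
  have "(\<Sum>u\<in>T. \<Sum>v\<in>T. cnj (\<psi> u) * M u v * \<psi> v) = (\<Sum>u\<in>S. \<Sum>v\<in>S. cnj (\<phi> u) * M u v * \<phi> v)"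
    using assms(2,3)
    by (intro sum.mono_neutral_cong_left ballI sum.neutral) (auto simp: \<phi>_def)
  then show "0 \<le> (\<Sum>u\<in>T. \<Sum>v\<in>T. cnj (\<psi> u) * M u v * \<psi> v)"
    using psd_onD[OF assms(1)] by simp
qed

lemma psd_on_diag:
  assumes "psd_on S M" "finite S" "s \<in> S"
  shows "0 \<le> M s s"
proof -
  have "psd_on {s} M" using psd_on_subset[OF assms(1) _ assms(2)] assms(3) by simp
  from psd_onD[OF this, of "\<lambda>_. 1"] show ?thesis by simp
qed

lemma psd_on_two_points:
  assumes "psd_on S M" "finite S" "s \<in> S" "t \<in> S" "s \<noteq> t"
  shows "0 \<le> cnj p * M s s * p + cnj p * M s t * q + cnj q * M t s * p + cnj q * M t t * q"
proof -
  have "psd_on {s,t} M" using psd_on_subset[OF assms(1) _ assms(2)] assms(3,4) by simp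
  from psd_onD[OF this, of "\<lambda>x. if x = s then p else q"] assms(5) show ?thesis
    by (simp add: add.assoc)
qed

lemma psd_on_hermitian:
  assumes "psd_on S M" "finite S" "s \<in> S" "t \<in> S"
  shows "M t s = cnj (M s t)"
proof (cases "s = t")
  case True
  then show ?thesis using psd_on_diag[OF assms(1-3)]
    by (simp add: less_eq_complex_def complex_eq_iff)
next
  case False
  \<comment> \<open>Polarisation: the form is real at the weights (1, 1), which matches imaginary
    parts of \<open>M s t\<close> and \<open>M t s\<close>, and at (i, 1), which matches real
    parts.\<close>
  note two = psd_on_two_points[OF assms False]
  from two[of 1 1] two[of \<i> 1] psd_on_diag[OF assms(1-3)] psd_on_diag[OF assms(1,2,4)]
  show ?thesis by (simp add: less_eq_complex_def complex_eq_iff)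
qed

lemma psd_on_zero_diag:
  assumes "psd_on S M" "finite S" "s \<in> S" "t \<in> S" "M s s = 0"
  shows "M s t = 0"
proof (rule ccontr)
  assume nz: "M s t \<noteq> 0"
  then have "s \<noteq> t" using assms(5) by auto
  note two = psd_on_two_points[OF assms(1-4) this]
  define n where "n = (cmod (M s t))\<^sup>2"
  have "n > 0" using nz by (simp add: n_def)
  \<comment> \<open>Scaled so that the cross terms contribute \<open>-2 * r * n\<close>, that is
    \<open>-2 * (Re (M t t) + 1)\<close>, which \<open>M t t\<close> cannot compensate.\<close>
  define r where "r = (Re (M t t) + 1) / n"
  have h: "M t s = cnj (M s t)" by (rule psd_on_hermitian[OF assms(1-4)])
  have e: "M s t * cnj (M s t) = of_real n" "cnj (M s t) * M s t = of_real n"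
    unfolding n_def by (simp_all only: complex_norm_square mult.commute)
  have "0 \<le> - (of_real (2 * r * n) :: complex) + M t t"
    using two[of "- of_real r * M s t" 1] assms(5)
    by (simp add: h e mult.assoc mult.left_commute algebra_simps)
  then have "2 * r * n \<le> Re (M t t)" by (simp add: less_eq_complex_def)
  moreover have "r * n = Re (M t t) + 1" using \<open>n > 0\<close> by (simp add: r_def)
  moreover have "0 \<le> Re (M t t)" using psd_on_diag[OF assms(1,2,4)] by (simp add: less_eq_complex_def)
  ultimately show False by simp
qed

lemma psd_on_schur_complement:
  assumes psd: "psd_on (insert s S) M" and fin: "finite S" and "s \<notin> S" and nz: "M s s \<noteq> 0"
  shows "psd_on S (\<lambda>u v. M u v - M u s * M s v / M s s)"
  unfolding psd_on_def
proof
  fix \<psi> :: "'a \<Rightarrow> complex"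
  define y where "y = (\<Sum>v\<in>S. M s v * \<psi> v)"
  \<comment> \<open>The coordinate at \<open>s\<close> that minimises the form for given
    \<open>\<psi>\<close> on \<open>S\<close>; at this minimum the form of \<open>M\<close> equals
    the form of the Schur complement.\<close>
  define p where "p = - y / M s s"
  define \<phi> where "\<phi> = \<psi>(s := p)"
  have real: "cnj (M s s) = M s s"
    using psd_on_diag[OF psd, of s] fin by (simp add: less_eq_complex_def complex_eq_iff)
  have herm: "M u s = cnj (M s u)" if "u \<in> S" for u
    using psd_on_hermitian[OF psd, of s u] fin that by simp
  have phi: "\<phi> u = \<psi> u" if "u \<in> S" for u
    using that assms(3) by (auto simp: \<phi>_def)
  have phis: "\<phi> s = p" by (simp add: \<phi>_def)
  have cy: "(\<Sum>u\<in>S. cnj (\<psi> u) * M u s) = cnj y"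
    unfolding y_def cnj_sum by (intro sum.cong refl) (simp add: herm)
  have "(\<Sum>u\<in>insert s S. \<Sum>v\<in>insert s S. cnj (\<phi> u) * M u v * \<phi> v)
      = cnj p * M s s * p + cnj p * y + (\<Sum>u\<in>S. cnj (\<psi> u) * M u s) * p
        + (\<Sum>u\<in>S. \<Sum>v\<in>S. cnj (\<psi> u) * M u v * \<psi> v)"
    using assms(3) fin
    by (simp add: phi phis y_def sum.distrib sum_distrib_left sum_distrib_right mult.assoc add.assoc)
  also have "cnj p * M s s * p + cnj p * y + (\<Sum>u\<in>S. cnj (\<psi> u) * M u s) * p = - (cnj y * y / M s s)"
    using nz by (simp add: cy p_def real field_simps)
  also have "(\<Sum>u\<in>S. \<Sum>v\<in>S. cnj (\<psi> u) * (M u v - M u s * M s v / M s s) * \<psi> v)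
      = (\<Sum>u\<in>S. \<Sum>v\<in>S. cnj (\<psi> u) * M u v * \<psi> v) - (\<Sum>u\<in>S. cnj (\<psi> u) * M u s) * y / M s s"
    by (simp add: y_def sum_subtractf sum_distrib_left sum_distrib_right sum_divide_distrib algebra_simps)
  ultimately show "0 \<le> (\<Sum>u\<in>S. \<Sum>v\<in>S. cnj (\<psi> u) * (M u v - M u s * M s v / M s s) * \<psi> v)"
    using psd_onD[OF psd, of \<phi>] by (simp add: cy)
qed

text \<open>Cholesky elimination: a zero pivot has zero row and column, a nonzero pivot splits off a
  rank-one term and leaves the Schur complement. Positivity is used below almost always in this Gram
  form.\<close>

lemma psd_on_gram:
  assumes "finite S" "psd_on S M"
  shows "\<exists>m. \<forall>u\<in>S. \<forall>v\<in>S. M u v = (\<Sum>l\<in>S. m l u * cnj (m l v))"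
  using assms
proof (induction S arbitrary: M rule: finite_induct)
  case empty
  then show ?case by simp
next
  case (insert s S)
  show ?case
  proof (cases "M s s = 0")
    case True
    have z: "M s v = 0" "M v s = 0" if "v \<in> insert s S" for v
    proof -
      show "M s v = 0" using psd_on_zero_diag[OF insert.prems, of s v] insert.hyps that True by simp
      then show "M v s = 0" using psd_on_hermitian[OF insert.prems, of s v] insert.hyps that by simp
    qed
    have "psd_on S M" using psd_on_subset[OF insert.prems] insert.hyps by auto
    from insert.IH[OF this] obtain m where
      m: "\<forall>u\<in>S. \<forall>v\<in>S. M u v = (\<Sum>l\<in>S. m l u * cnj (m l v))" by auto
    define m' where "m' = (\<lambda>l u. if l = s \<or> u = s then 0 else m l u)"
    have "M u v = (\<Sum>l\<in>insert s S. m' l u * cnj (m' l v))" if uv: "u \<in> insert s S" "v \<in> insert s S" for u v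
    proof (cases "u = s \<or> v = s")
      case True then show ?thesis using z uv by (auto simp: m'_def)
    next
      case False
      have "(\<Sum>l\<in>S. m' l u * cnj (m' l v)) = (\<Sum>l\<in>S. m l u * cnj (m l v))"
        using insert.hyps False by (intro sum.cong) (auto simp: m'_def)
      then show ?thesis using False uv m insert.hyps by (simp add: m'_def)
    qed
    then show ?thesis by blast
  next
    case False
    from insert.IH[OF psd_on_schur_complement[OF insert.prems insert.hyps False]] obtain m where
      m: "\<forall>u\<in>S. \<forall>v\<in>S. M u v - M u s * M s v / M s s = (\<Sum>l\<in>S. m l u * cnj (m l v))" by auto
    have pos: "0 \<le> M s s" using psd_on_diag[OF insert.prems] insert.hyps by simp
    define r where "r = Re (M s s)"
    have r: "M s s = of_real r" "r > 0"
      using pos False by (auto simp: r_def less_eq_complex_def complex_eq_iff)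
    have sq: "complex_of_real (sqrt r) * complex_of_real (sqrt r) = of_real r"
      using r(2) by (simp flip: of_real_mult)
    \<comment> \<open>The new vector is the pivot column divided by the root of the pivot; the old
      ones are extended by 0 at \<open>s\<close>, where the Schur complement vanishes.\<close>
    define m' where "m' = (\<lambda>l u. if l = s then M u s / of_real (sqrt r) else if u = s then 0 else m l u)"
    have "M u v = (\<Sum>l\<in>insert s S. m' l u * cnj (m' l v))" if uv: "u \<in> insert s S" "v \<in> insert s S" for u v
    proof -
      have hv: "cnj (M v s) = M s v"
        using psd_on_hermitian[OF insert.prems, of v s] insert.hyps uv by simp
      have first: "m' s u * cnj (m' s v) = M u s * M s v / M s s"
        by (simp add: m'_def hv r(1) sq)
      have rest: "(\<Sum>l\<in>S. m' l u * cnj (m' l v)) = M u v - M u s * M s v / M s s"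
      proof (cases "u = s \<or> v = s")
        case True
        have "(\<Sum>l\<in>S. m' l u * cnj (m' l v)) = 0"
          using insert.hyps True by (intro sum.neutral) (auto simp: m'_def)
        then show ?thesis using True False by auto
      next
        case nuv: False
        have "(\<Sum>l\<in>S. m' l u * cnj (m' l v)) = (\<Sum>l\<in>S. m l u * cnj (m l v))"
          using insert.hyps nuv by (intro sum.cong) (auto simp: m'_def)
        then show ?thesis using nuv uv m by simp
      qed
      show ?thesis using first rest insert.hyps by simp
    qed
    then show ?thesis by blast
  qed
qed

lemma cnj_mult_self_nonneg: "0 \<le> cnj z * z" for z :: complex
  by (simp add: less_eq_complex_def)

lemma psd_on_of_gram:
  assumes "\<And>u v. u \<in> S \<Longrightarrow> v \<in> S \<Longrightarrow> M u v = (\<Sum>l\<in>L. m l u * cnj (m l v))"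
  shows "psd_on S M"
  unfolding psd_on_def
proof
  fix \<psi> :: "'a \<Rightarrow> complex"
  have "(\<Sum>u\<in>S. \<Sum>v\<in>S. cnj (\<psi> u) * M u v * \<psi> v)
      = (\<Sum>u\<in>S. \<Sum>v\<in>S. \<Sum>l\<in>L. (m l u * cnj (\<psi> u)) * (cnj (m l v) * \<psi> v))"
    using assms by (simp add: sum_distrib_left sum_distrib_right mult_ac)
  also have "\<dots> = (\<Sum>l\<in>L. \<Sum>u\<in>S. \<Sum>v\<in>S. (m l u * cnj (\<psi> u)) * (cnj (m l v) * \<psi> v))"
    by (subst (2) sum.swap, subst sum.swap) simp
  also have "\<dots> = (\<Sum>l\<in>L. cnj (\<Sum>v\<in>S. cnj (m l v) * \<psi> v) * (\<Sum>v\<in>S. cnj (m l v) * \<psi> v))"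
    by (simp add: sum_product)
  also have "\<dots> \<ge> 0"
    by (intro sum_nonneg cnj_mult_self_nonneg)
  finally show "0 \<le> (\<Sum>u\<in>S. \<Sum>v\<in>S. cnj (\<psi> u) * M u v * \<psi> v)" .
qed

lemma psd_on_transpose:
  assumes "psd_on S M"
  shows "psd_on S (\<lambda>u v. M v u)"
  unfolding psd_on_def
proof
  fix \<psi> :: "'a \<Rightarrow> complex"
  have "(\<Sum>u\<in>S. \<Sum>v\<in>S. cnj (\<psi> u) * M v u * \<psi> v) = (\<Sum>u\<in>S. \<Sum>v\<in>S. cnj (cnj (\<psi> u)) * M u v * cnj (\<psi> v))"
    by (subst sum.swap) (simp add: mult_ac)
  also have "\<dots> \<ge> 0" by (rule psd_onD[OF assms])
  finally show "0 \<le> (\<Sum>u\<in>S. \<Sum>v\<in>S. cnj (\<psi> u) * M v u * \<psi> v)" .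
qed

lemma psd_on_sum:
  fixes M :: "'c \<Rightarrow> 'a cmat"
  assumes "\<And>x. x \<in> L \<Longrightarrow> psd_on S (M x)"
  shows "psd_on S (\<lambda>u v. \<Sum>x\<in>L. M x u v)"
  unfolding psd_on_def
proof
  fix \<psi> :: "'a \<Rightarrow> complex"
  have "(\<Sum>u\<in>S. \<Sum>v\<in>S. cnj (\<psi> u) * (\<Sum>x\<in>L. M x u v) * \<psi> v)
     = (\<Sum>x\<in>L. \<Sum>u\<in>S. \<Sum>v\<in>S. cnj (\<psi> u) * M x u v * \<psi> v)"
    by (simp add: sum_distrib_left sum_distrib_right, subst (2) sum.swap, subst sum.swap) simp
  also have "\<dots> \<ge> 0" using assms by (intro sum_nonneg psd_onD)
  finally show "0 \<le> (\<Sum>u\<in>S. \<Sum>v\<in>S. cnj (\<psi> u) * (\<Sum>x\<in>L. M x u v) * \<psi> v)" .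
qed

subsection \<open>Choi matrices\<close>

abbreviation cell :: "nat \<Rightarrow> nat \<Rightarrow> (nat \<times> nat) set" where
  "cell d e \<equiv> {..<d} \<times> {..<e}"

lemma finite_pm_basis [simp]: "finite (pm_basis N dI dO)"
  by (simp add: pm_basis_def finite_PiE)

lemma pm_basis_cell: "u \<in> pm_basis N dI dO \<Longrightarrow> k < N \<Longrightarrow> u k \<in> cell (dI k) (dO k)"
  by (auto simp: pm_basis_def PiE_def Pi_def)

lemma tr_prod_cong:
  assumes "\<And>k u v. k < N \<Longrightarrow> u \<in> cell (dI k) (dO k) \<Longrightarrow> v \<in> cell (dI k) (dO k) \<Longrightarrow> M k u v = M' k u v"
  shows "tr_prod N dI dO W M = tr_prod N dI dO W M'"
  unfolding tr_prod_def
  by (intro sum.cong prod.cong arg_cong2[where f = "(*)"] assms refl) (auto dest: pm_basis_cell)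

text \<open>Multilinearity. It turns a product of instruments, each summed over its own outcomes,
  into a sum over joint outcomes.\<close>

lemma tr_prod_expand:
  assumes "\<And>k. k < N \<Longrightarrow> finite (Y k)"
  shows "tr_prod N dI dO W (\<lambda>k u v. \<Sum>y\<in>Y k. D k y u v)
       = (\<Sum>y\<in>PiE {..<N} Y. tr_prod N dI dO W (\<lambda>k. D k (y k)))"
proof -
  have "(\<Prod>k<N. \<Sum>y\<in>Y k. D k y (v k) (u k)) = (\<Sum>y\<in>PiE {..<N} Y. \<Prod>k<N. D k (y k) (v k) (u k))" for u v
    using assms by (intro prod_sum_PiE) auto
  then show ?thesis
    unfolding tr_prod_def
    by (simp add: sum_distrib_left, subst (2) sum.swap, subst sum.swap) simp
qed

lemma tr_prod_slot:
  assumes "k < N"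
  shows "tr_prod N dI dO W (M(k := (\<lambda>u v. \<Sum>l\<in>L. c l * G l u v)))
       = (\<Sum>l\<in>L. c l * tr_prod N dI dO W (M(k := G l)))"
proof -
  have split: "(\<Prod>j<N. (M(k := Z)) j (v j) (u j)) = Z (v k) (u k) * (\<Prod>j\<in>{..<N}-{k}. M j (v j) (u j))" for Z u v
  proof -
    have "(\<Prod>j\<in>{..<N}-{k}. (M(k := Z)) j (v j) (u j)) = (\<Prod>j\<in>{..<N}-{k}. M j (v j) (u j))"
      by (intro prod.cong) auto
    then show ?thesis using assms by (simp add: prod.remove[of "{..<N}" k])
  qed
  show ?thesis
    unfolding tr_prod_def split
    by (simp add: sum_distrib_left sum_distrib_right mult_ac, subst (2) sum.swap, subst sum.swap) simp
qed

text \<open>Gram vectors in every slot reduce the trace to a sum of forms of \<open>W\<close>, each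
  taken at a product vector.\<close>

lemma tr_prod_nonneg:
  assumes W: "psd_on (pm_basis N dI dO) W"
    and M: "\<And>k. k < N \<Longrightarrow> psd_on (cell (dI k) (dO k)) (M k)"
  shows "0 \<le> tr_prod N dI dO W M"
proof -
  have "\<forall>k. \<exists>m. k < N \<longrightarrow> (\<forall>u\<in>cell (dI k) (dO k). \<forall>v\<in>cell (dI k) (dO k).
      M k u v = (\<Sum>l\<in>cell (dI k) (dO k). m l u * cnj (m l v)))"
    using psd_on_gram[OF _ M] by simp
  from choice[OF this] obtain m where m: "\<And>k u v. k < N \<Longrightarrow> u \<in> cell (dI k) (dO k) \<Longrightarrow>
      v \<in> cell (dI k) (dO k) \<Longrightarrow> M k u v = (\<Sum>l\<in>cell (dI k) (dO k). m k l u * cnj (m k l v))"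
    by blast
  have "tr_prod N dI dO W M
      = tr_prod N dI dO W (\<lambda>k u v. \<Sum>l\<in>cell (dI k) (dO k). m k l u * cnj (m k l v))"
    by (rule tr_prod_cong) (rule m)
  also have "\<dots> = (\<Sum>l\<in>PiE {..<N} (\<lambda>k. cell (dI k) (dO k)).
      tr_prod N dI dO W (\<lambda>k u v. m k (l k) u * cnj (m k (l k) v)))"
    by (rule tr_prod_expand) simp
  also have "\<dots> \<ge> 0"
  proof (rule sum_nonneg)
    fix l assume "l \<in> PiE {..<N} (\<lambda>k. cell (dI k) (dO k))"
    have "tr_prod N dI dO W (\<lambda>k u v. m k (l k) u * cnj (m k (l k) v))
      = (\<Sum>u\<in>pm_basis N dI dO. \<Sum>v\<in>pm_basis N dI dO.
          cnj (\<Prod>k<N. m k (l k) (u k)) * W u v * (\<Prod>k<N. m k (l k) (v k)))"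
      unfolding tr_prod_def by (simp add: prod.distrib mult_ac)
    also have "\<dots> \<ge> 0" by (rule psd_onD[OF W])
    finally show "0 \<le> tr_prod N dI dO W (\<lambda>k u v. m k (l k) u * cnj (m k (l k) v))" .
  qed
  finally show ?thesis .
qed

section \<open>Channels and realizations in terms of Choi matrices\<close>

text \<open>The second condition is trace preservation: the partial trace over the output is the
  identity. The transposition in \<open>cj\<close> leaves both conditions intact.\<close>

definition chan :: "nat \<Rightarrow> nat \<Rightarrow> (nat \<times> nat) cmat \<Rightarrow> bool" where
  "chan d e C \<longleftrightarrow> psd_on (cell d e) C \<and>
     (\<forall>j<d. \<forall>j'<d. (\<Sum>r<e. C (j, r) (j', r)) = (if j = j' then 1 else 0))"

text \<open>Inverse of the Choi correspondence; entries outside the output block are set to 0 so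
  that the result lies in \<open>mats\<close>.\<close>

definition choi_map :: "nat \<Rightarrow> nat \<Rightarrow> (nat \<times> nat) cmat \<Rightarrow> nat cmat \<Rightarrow> nat cmat" where
  "choi_map d e C = (\<lambda>M r' r. if r' < e \<and> r < e then \<Sum>j<d. \<Sum>j'<d. M j' j * C (j, r) (j', r') else 0)"

lemma cj_choi_map:
  assumes "u \<in> cell d e" "v \<in> cell d e"
  shows "cj (choi_map d e C) u v = C u v"
proof -
  obtain j r j' r' where uv: "u = (j, r)" "v = (j', r')" by (metis surj_pair)
  have "(\<Sum>i<d. \<Sum>i'<d. munit j' j i' i * C (i, r) (i', r'))
      = (\<Sum>i<d. \<Sum>i'<d. if i' = j' then (if i = j then C (j, r) (j', r') else 0) else 0)"
    by (intro sum.cong refl) (simp add: munit_def)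
  also have "\<dots> = C (j, r) (j', r')" using assms uv by simp
  finally show ?thesis using assms uv by (simp add: cj_def choi_map_def)
qed

text \<open>The conjugated Gram vectors of \<open>C\<close> act as Kraus operators; the conjugation
  comes from the transposition in \<open>cj\<close>. Applied to the Gram vectors of
  \<open>Y\<close>, they give the Gram vectors \<open>w\<close> of the image.\<close>

lemma completely_positive_choi_map:
  assumes "psd_on (cell d e) C"
  shows "completely_positive d e (choi_map d e C)"
  unfolding completely_positive_def
proof (intro conjI allI impI)
  show "linear_map d e (choi_map d e C)"
    by (auto simp: linear_map_def choi_map_def mats_def fun_eq_iff sum.distrib sum_distrib_left algebra_simps)
next
  fix n and Y :: "(nat \<times> nat) cmat"
  assume Y: "psd_on ({..<n} \<times> {..<d}) Y"
  obtain y where y: "\<And>u v. u \<in> cell n d \<Longrightarrow> v \<in> cell n d \<Longrightarrow> Y u v = (\<Sum>s\<in>cell n d. y s u * cnj (y s v))"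
    using psd_on_gram[OF _ Y] by auto
  obtain m where m: "\<And>u v. u \<in> cell d e \<Longrightarrow> v \<in> cell d e \<Longrightarrow> C u v = (\<Sum>l\<in>cell d e. m l u * cnj (m l v))"
    using psd_on_gram[OF _ assms] by auto
  define w where "w = (\<lambda>(s, l) (a, r). \<Sum>j<d. y s (a, j) * cnj (m l (j, r)))"
  show "psd_on ({..<n} \<times> {..<e}) (ampl d (choi_map d e C) Y)"
  proof (rule psd_on_of_gram)
    fix u v assume uv: "u \<in> cell n e" "v \<in> cell n e"
    obtain a r b r' where e: "u = (a, r)" "v = (b, r')" by (metis surj_pair)
    have "ampl d (choi_map d e C) Y u v = (\<Sum>j<d. \<Sum>j'<d. Y (a, j') (b, j) * C (j, r') (j', r))"
      using uv by (auto simp: ampl_def choi_map_def e intro!: sum.cong)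
    also have "\<dots> = (\<Sum>j<d. \<Sum>j'<d. \<Sum>(s,l)\<in>cell n d \<times> cell d e.
        (y s (a, j') * cnj (m l (j', r))) * (cnj (y s (b, j)) * m l (j, r')))"
    proof (intro sum.cong refl)
      fix j j' assume "j \<in> {..<d}" "j' \<in> {..<d}"
      then have "Y (a, j') (b, j) * C (j, r') (j', r)
          = (\<Sum>s\<in>cell n d. y s (a, j') * cnj (y s (b, j))) * (\<Sum>l\<in>cell d e. m l (j, r') * cnj (m l (j', r)))"
        using uv by (simp add: y m e)
      also have "\<dots> = (\<Sum>(s,l)\<in>cell n d \<times> cell d e.
          (y s (a, j') * cnj (m l (j', r))) * (cnj (y s (b, j)) * m l (j, r')))"
        unfolding sum_product sum.cartesian_product by (intro sum.cong refl) (simp add: case_prod_unfold mult_ac)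
      finally show "Y (a, j') (b, j) * C (j, r') (j', r) = (\<Sum>(s,l)\<in>cell n d \<times> cell d e.
          (y s (a, j') * cnj (m l (j', r))) * (cnj (y s (b, j)) * m l (j, r')))" .
    qed
    also have "\<dots> = (\<Sum>(s,l)\<in>cell n d \<times> cell d e. \<Sum>j'<d. \<Sum>j<d.
        (y s (a, j') * cnj (m l (j', r))) * (cnj (y s (b, j)) * m l (j, r')))"
      unfolding case_prod_unfold
      by (rule trans[OF sum.cong[OF refl sum.swap]], subst sum.swap, rule sum.cong[OF refl], rule sum.swap)
    also have "\<dots> = (\<Sum>t\<in>cell n d \<times> cell d e. w t u * cnj (w t v))"
      by (simp add: w_def e sum_product case_prod_unfold)
    finally show "ampl d (choi_map d e C) Y u v = (\<Sum>t\<in>cell n d \<times> cell d e. w t u * cnj (w t v))" .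
  qed
qed

lemma cptp_choi_map:
  assumes "chan d e C"
  shows "cptp d e (choi_map d e C)"
  unfolding cptp_def
proof
  show "completely_positive d e (choi_map d e C)"
    using assms by (simp add: chan_def completely_positive_choi_map)
  show "trace_preserving d e (choi_map d e C)"
    unfolding trace_preserving_def
  proof
    fix M assume "M \<in> mats d"
    have "mtrace e (choi_map d e C M) = (\<Sum>r<e. \<Sum>j<d. \<Sum>j'<d. M j' j * C (j, r) (j', r))"
      by (simp add: mtrace_def choi_map_def)
    also have "\<dots> = (\<Sum>j<d. \<Sum>j'<d. M j' j * (\<Sum>r<e. C (j, r) (j', r)))"
      unfolding sum_distrib_left by (subst sum.swap, rule sum.cong[OF refl], rule sum.swap)
    also have "\<dots> = (\<Sum>j<d. \<Sum>j'<d. if j' = j then M j j else 0)"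
      using assms by (intro sum.cong refl) (auto simp: chan_def)
    also have "\<dots> = mtrace d M" by (simp add: mtrace_def)
    finally show "mtrace e (choi_map d e C M) = mtrace d M" .
  qed
qed

lemma psd_on_cj:
  assumes "completely_positive d e \<Phi>"
  shows "psd_on (cell d e) (cj \<Phi>)"
proof -
  \<comment> \<open>The unnormalised maximally entangled matrix; amplification maps it to the
    transpose of \<open>cj \<Phi>\<close>.\<close>
  define Y :: "(nat \<times> nat) cmat" where "Y = (\<lambda>(a, i) (b, j). if a = i \<and> b = j then 1 else 0)"
  have "psd_on (cell d d) Y"
    by (rule psd_on_of_gram[where L = "{()}" and m = "\<lambda>_ (a, i). if a = i then 1 else 0"])
      (auto simp: Y_def)
  then have "psd_on (cell d e) (ampl d \<Phi> Y)"
    using assms by (simp add: completely_positive_def)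
  then have "psd_on (cell d e) (\<lambda>u v. ampl d \<Phi> Y v u)"
    by (rule psd_on_transpose)
  also have "?this \<longleftrightarrow> psd_on (cell d e) (cj \<Phi>)"
  proof (rule psd_on_cong)
    fix u v assume uv: "u \<in> cell d e" "v \<in> cell d e"
    obtain j r j' r' where e: "u = (j, r)" "v = (j', r')" by (metis surj_pair)
    have "(\<lambda>i l. if i < d \<and> l < d then Y (j', i) (j, l) else 0) = munit j' j"
      using uv by (auto simp: munit_def Y_def e fun_eq_iff)
    then show "ampl d \<Phi> Y v u = cj \<Phi> u v" by (simp add: cj_def ampl_def e)
  qed
  finally show ?thesis .
qed

lemma chan_cj:
  assumes "cptp d e \<Phi>"
  shows "chan d e (cj \<Phi>)"
  unfolding chan_def
proof (intro conjI allI impI)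
  show "psd_on (cell d e) (cj \<Phi>)" using assms by (simp add: cptp_def psd_on_cj)
  fix j j' assume j: "j < d" "j' < d"
  have "munit j' j \<in> mats d" using j by (auto simp: mats_def munit_def)
  then have "mtrace e (\<Phi> (munit j' j)) = mtrace d (munit j' j)"
    using assms by (simp add: cptp_def trace_preserving_def)
  also have "mtrace d (munit j' j) = (\<Sum>i<d. if i = j then (if j = j' then 1 else 0) else 0)"
    unfolding mtrace_def munit_def by (intro sum.cong) auto
  also have "\<dots> = (if j = j' then 1 else 0)" using j by simp
  finally show "(\<Sum>r<e. cj \<Phi> (j, r) (j', r)) = (if j = j' then 1 else 0)"
    by (simp add: cj_def mtrace_def)
qed

text \<open>A realization without any maps: from here on Choi matrices are summed, compressed and
  completed directly, and linearity and complete positivity of maps need not be checked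
  again.\<close>

definition choi_correlation ::
  "nat \<Rightarrow> (nat \<Rightarrow> 'a set) \<Rightarrow> (nat \<Rightarrow> 'x set) \<Rightarrow> ((nat \<Rightarrow> 'a) \<Rightarrow> (nat \<Rightarrow> 'x) \<Rightarrow> real) \<Rightarrow>
   (nat \<Rightarrow> nat) \<Rightarrow> (nat \<Rightarrow> nat) \<Rightarrow> (nat \<Rightarrow> nat \<times> nat) cmat \<Rightarrow> (nat \<Rightarrow> 'a \<Rightarrow> 'x \<Rightarrow> (nat \<times> nat) cmat) \<Rightarrow> bool" where
  "choi_correlation N A X p dI dO W C \<longleftrightarrow>
     (\<forall>k<N. 0 < dI k \<and> 0 < dO k) \<and>
     psd_on (pm_basis N dI dO) W \<and>
     (\<forall>D. (\<forall>k<N. chan (dI k) (dO k) (D k)) \<longrightarrow> tr_prod N dI dO W D = 1) \<and>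
     (\<forall>k<N. \<forall>a\<in>A k. (\<forall>x\<in>X k. psd_on (cell (dI k) (dO k)) (C k a x)) \<and>
        chan (dI k) (dO k) (\<lambda>u v. \<Sum>x\<in>X k. C k a x u v)) \<and>
     (\<forall>a\<in>PiE {..<N} A. \<forall>x\<in>PiE {..<N} X.
        complex_of_real (p a x) = tr_prod N dI dO W (\<lambda>k. C k (a k) (x k)))"

lemma quantum_process_correlation_iff_choi:
  "quantum_process_correlation N A X p \<longleftrightarrow> (\<exists>dI dO W C. choi_correlation N A X p dI dO W C)"
proof
  assume "quantum_process_correlation N A X p"
  then obtain dI dO W \<Psi> where
    pos: "\<forall>k<N. 0 < dI k \<and> 0 < dO k" and
    W: "process_matrix N dI dO W" and
    ins: "\<forall>k<N. \<forall>a\<in>A k. instrument (dI k) (dO k) (X k) (\<Psi> k a)" and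
    cor: "\<forall>a\<in>PiE {..<N} A. \<forall>x\<in>PiE {..<N} X.
           complex_of_real (p a x) = tr_prod N dI dO W (\<lambda>k. cj (\<Psi> k (a k) (x k)))"
    unfolding quantum_process_correlation_def by blast
  have "tr_prod N dI dO W D = 1" if D: "\<forall>k<N. chan (dI k) (dO k) (D k)" for D
  proof -
    have "tr_prod N dI dO W D = tr_prod N dI dO W (\<lambda>k. cj (choi_map (dI k) (dO k) (D k)))"
      by (rule tr_prod_cong) (simp add: cj_choi_map)
    also have "\<dots> = 1"
      using W[unfolded process_matrix_def, THEN conjunct2, THEN spec, of "\<lambda>k. choi_map (dI k) (dO k) (D k)"] D
      by (simp add: cptp_choi_map)
    finally show ?thesis .
  qed
  moreover have "psd_on (cell (dI k) (dO k)) (cj (\<Psi> k a x))" if "k < N" "a \<in> A k" "x \<in> X k" for k a x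
    using ins that by (auto simp: instrument_def intro!: psd_on_cj)
  moreover have "chan (dI k) (dO k) (\<lambda>u v. \<Sum>x\<in>X k. cj (\<Psi> k a x) u v)" if "k < N" "a \<in> A k" for k a
  proof -
    have "chan (dI k) (dO k) (cj (\<lambda>M i j. \<Sum>x\<in>X k. \<Psi> k a x M i j))"
      using ins that by (auto simp: instrument_def intro!: chan_cj)
    then show ?thesis by (simp add: cj_def case_prod_unfold)
  qed
  ultimately have "choi_correlation N A X p dI dO W (\<lambda>k a x. cj (\<Psi> k a x))"
    using pos W cor by (simp add: choi_correlation_def process_matrix_def)
  then show "\<exists>dI dO W C. choi_correlation N A X p dI dO W C" by blast
next
  assume "\<exists>dI dO W C. choi_correlation N A X p dI dO W C"
  then obtain dI dO W C where c: "choi_correlation N A X p dI dO W C" by blast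
  define \<Psi> where "\<Psi> = (\<lambda>k a x. choi_map (dI k) (dO k) (C k a x))"
  have "process_matrix N dI dO W"
    unfolding process_matrix_def
  proof (intro conjI allI impI)
    show "psd_on (pm_basis N dI dO) W" using c by (simp add: choi_correlation_def)
    fix \<Phi> assume "\<forall>k<N. cptp (dI k) (dO k) (\<Phi> k)"
    then have "\<forall>k<N. chan (dI k) (dO k) (cj (\<Phi> k))" by (simp add: chan_cj)
    then show "tr_prod N dI dO W (\<lambda>k. cj (\<Phi> k)) = 1"
      using c unfolding choi_correlation_def by simp
  qed
  moreover have "instrument (dI k) (dO k) (X k) (\<Psi> k a)" if k: "k < N" "a \<in> A k" for k a
  proof -
    have "(\<lambda>M i j. \<Sum>x\<in>X k. \<Psi> k a x M i j) = choi_map (dI k) (dO k) (\<lambda>u v. \<Sum>x\<in>X k. C k a x u v)"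
    proof (intro ext)
      fix M i j
      show "(\<Sum>x\<in>X k. \<Psi> k a x M i j) = choi_map (dI k) (dO k) (\<lambda>u v. \<Sum>x\<in>X k. C k a x u v) M i j"
      proof (cases "i < dO k \<and> j < dO k")
        case True
        have "(\<Sum>l<dI k. \<Sum>l'<dI k. M l' l * (\<Sum>x\<in>X k. C k a x (l, j) (l', i)))
            = (\<Sum>x\<in>X k. \<Sum>l<dI k. \<Sum>l'<dI k. M l' l * C k a x (l, j) (l', i))"
          unfolding sum_distrib_left
          by (rule trans[OF sum.cong[OF refl sum.swap]], rule sum.swap)
        then show ?thesis using True by (simp add: \<Psi>_def choi_map_def)
      qed (auto simp: \<Psi>_def choi_map_def)
    qed
    then show ?thesis
      using c k by (auto simp: choi_correlation_def instrument_def \<Psi>_def completely_positive_choi_map cptp_choi_map)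
  qed
  moreover have "complex_of_real (p a x) = tr_prod N dI dO W (\<lambda>k. cj (\<Psi> k (a k) (x k)))"
    if "a \<in> PiE {..<N} A" "x \<in> PiE {..<N} X" for a x
  proof -
    have "complex_of_real (p a x) = tr_prod N dI dO W (\<lambda>k. C k (a k) (x k))"
      using c that by (simp add: choi_correlation_def)
    also have "\<dots> = tr_prod N dI dO W (\<lambda>k. cj (\<Psi> k (a k) (x k)))"
      by (rule tr_prod_cong) (simp add: \<Psi>_def cj_choi_map)
    finally show ?thesis .
  qed
  ultimately show "quantum_process_correlation N A X p"
    using c unfolding quantum_process_correlation_def choi_correlation_def
    by (intro exI[of _ dI] exI[of _ dO] exI[of _ W] exI[of _ \<Psi>]) simp
qed

subsection \<open>From process functions to process matrices\<close>

lemma prod_if_zero: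
  fixes F :: "'k \<Rightarrow> complex"
  assumes "finite S"
  shows "(\<Prod>k\<in>S. if Q k then F k else 0) = (if \<forall>k\<in>S. Q k then \<Prod>k\<in>S. F k else 0)"
proof (cases "\<forall>k\<in>S. Q k")
  case True
  then show ?thesis by (auto intro!: prod.cong)
next
  case False
  then show ?thesis using assms by (auto intro!: prod_zero)
qed

text \<open>A stochastic local map is a mixture of functions \<open>h\<close>, and each function leaves exactly one
  fixed point.\<close>
lemma process_function_stochastic:
  fixes P :: "nat \<Rightarrow> 'i \<Rightarrow> 'o \<Rightarrow> complex"
  assumes pf: "process_function N A B \<omega>"
    and finA: "\<And>k. k < N \<Longrightarrow> finite (A k)" and finB: "\<And>k. k < N \<Longrightarrow> finite (B k)"
    and st: "\<And>k b. k < N \<Longrightarrow> b \<in> B k \<Longrightarrow> (\<Sum>y\<in>A k. P k b y) = 1"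
  shows "(\<Sum>y\<in>PiE {..<N} A. \<Prod>k<N. P k (\<omega> y k) (y k)) = 1"
proof -
  have finPi: "finite (PiE {..<N} A)" using finA by (intro finite_PiE) auto
  define H where "H = PiE {..<N} (\<lambda>k. PiE (B k) (\<lambda>_. A k))"
  define w where "w = (\<lambda>h. \<Prod>k<N. \<Prod>i\<in>B k. P k i (h k i))"
  have mix: "P k b y = (\<Sum>h\<in>PiE (B k) (\<lambda>_. A k). if h b = y then \<Prod>i\<in>B k. P k i (h i) else 0)"
    if k: "k < N" and b: "b \<in> B k" and y: "y \<in> A k" for k b y
  proof -
    have "P k b y = (\<Prod>i\<in>B k. if i = b then P k b y else 1)"
      using finB[OF k] b by simp
    \<comment> \<open>The guard restricts the value at \<open>b\<close> only, so every other row
      sums to 1; expanding the product then ranges over all functions with value \<open>y\<close> at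
      \<open>b\<close>.\<close>
    also have "\<dots> = (\<Prod>i\<in>B k. \<Sum>z\<in>A k. if i = b \<longrightarrow> z = y then P k i z else 0)"
    proof (intro prod.cong refl)
      fix i assume i: "i \<in> B k"
      show "(if i = b then P k b y else 1) = (\<Sum>z\<in>A k. if i = b \<longrightarrow> z = y then P k i z else 0)"
        using st[OF k i] finA[OF k] y by (cases "i = b") auto
    qed
    also have "\<dots> = (\<Sum>h\<in>PiE (B k) (\<lambda>_. A k). \<Prod>i\<in>B k. if i = b \<longrightarrow> h i = y then P k i (h i) else 0)"
      using finA finB k by (intro prod_sum_PiE) auto
    also have "\<dots> = (\<Sum>h\<in>PiE (B k) (\<lambda>_. A k). if h b = y then \<Prod>i\<in>B k. P k i (h i) else 0)"
      using b by (intro sum.cong refl, subst prod_if_zero) (auto simp: finB[OF k])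
    finally show ?thesis .
  qed
  have "(\<Prod>k<N. P k (\<omega> y k) (y k)) = (\<Sum>h\<in>H. if \<forall>k<N. h k (\<omega> y k) = y k then w h else 0)"
    if y: "y \<in> PiE {..<N} A" for y
  proof -
    have om: "\<omega> y \<in> PiE {..<N} B" using pf y by (simp add: process_function_def)
    have "(\<Prod>k<N. P k (\<omega> y k) (y k))
        = (\<Prod>k<N. \<Sum>h\<in>PiE (B k) (\<lambda>_. A k). if h (\<omega> y k) = y k then \<Prod>i\<in>B k. P k i (h i) else 0)"
      using y om by (intro prod.cong refl mix) (auto simp: PiE_def Pi_def)
    also have "\<dots> = (\<Sum>h\<in>H. \<Prod>k<N. if h k (\<omega> y k) = y k then \<Prod>i\<in>B k. P k i (h k i) else 0)"
      unfolding H_def by (rule prod_sum_PiE) (auto intro!: finite_PiE finA finB)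
    also have "\<dots> = (\<Sum>h\<in>H. if \<forall>k<N. h k (\<omega> y k) = y k then w h else 0)"
      unfolding w_def by (intro sum.cong refl, subst prod_if_zero) auto
    finally show ?thesis .
  qed
  then have "(\<Sum>y\<in>PiE {..<N} A. \<Prod>k<N. P k (\<omega> y k) (y k))
      = (\<Sum>y\<in>PiE {..<N} A. \<Sum>h\<in>H. if \<forall>k<N. h k (\<omega> y k) = y k then w h else 0)"
    by simp
  also have "\<dots> = (\<Sum>h\<in>H. \<Sum>y\<in>PiE {..<N} A. if \<forall>k<N. h k (\<omega> y k) = y k then w h else 0)"
    by (rule sum.swap)
  also have "\<dots> = (\<Sum>h\<in>H. w h)"
  proof (rule sum.cong[OF refl])
    fix h assume "h \<in> H"
    then have h: "h k i \<in> A k" if "k < N" "i \<in> B k" for k i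
      using that by (auto simp: H_def PiE_def Pi_def)
    have "\<forall>h. (\<forall>k<N. \<forall>i\<in>B k. h k i \<in> A k) \<longrightarrow> (\<exists>!i. i \<in> PiE {..<N} B \<and> \<omega> (\<lambda>k\<in>{..<N}. h k (i k)) = i)"
      using pf by (simp add: process_function_def)
    from this[THEN spec, of h] h
    have ex: "\<exists>!i. i \<in> PiE {..<N} B \<and> \<omega> (\<lambda>k\<in>{..<N}. h k (i k)) = i" by blast
    then obtain i where i: "i \<in> PiE {..<N} B" "\<omega> (\<lambda>k\<in>{..<N}. h k (i k)) = i" by blast
    define z where "z = (\<lambda>k\<in>{..<N}. h k (i k))"
    have z: "z \<in> PiE {..<N} A" using i(1) h by (auto simp: z_def PiE_def Pi_def)
    \<comment> \<open>Fixed points of "\<open>h\<close> after \<open>\<omega>\<close>" on the output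
      side correspond to fixed points of "\<open>\<omega>\<close> after \<open>h\<close>" on the
      input side, of which there is exactly one.\<close>
    have "(\<forall>k<N. h k (\<omega> y k) = y k) \<longleftrightarrow> y = z" if y: "y \<in> PiE {..<N} A" for y
    proof
      assume c: "\<forall>k<N. h k (\<omega> y k) = y k"
      have "\<omega> y \<in> PiE {..<N} B" using pf y by (simp add: process_function_def)
      moreover have yy: "(\<lambda>k\<in>{..<N}. h k (\<omega> y k)) = y"
        using c y by (auto simp: fun_eq_iff PiE_def extensional_def restrict_def)
      ultimately have "\<omega> y = i" using ex i by metis
      then show "y = z" using yy by (simp add: z_def)
    next
      assume "y = z"
      then show "\<forall>k<N. h k (\<omega> y k) = y k" using i(2) by (simp add: z_def)
    qed
    then have "(\<Sum>y\<in>PiE {..<N} A. if \<forall>k<N. h k (\<omega> y k) = y k then w h else 0)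
        = (\<Sum>y\<in>PiE {..<N} A. if y = z then w h else 0)"
      by (intro sum.cong refl) simp
    also have "\<dots> = w h" using z finPi by simp
    finally show "(\<Sum>y\<in>PiE {..<N} A. if \<forall>k<N. h k (\<omega> y k) = y k then w h else 0) = w h" .
  qed
  also have "\<dots> = (\<Prod>k<N. \<Sum>h\<in>PiE (B k) (\<lambda>_. A k). \<Prod>i\<in>B k. P k i (h i))"
    unfolding H_def w_def by (rule prod_sum_PiE[symmetric]) (auto intro!: finite_PiE finA finB)
  also have "\<dots> = (\<Prod>k<N. \<Prod>i\<in>B k. \<Sum>y\<in>A k. P k i y)"
    using finA finB by (intro prod.cong refl prod_sum_PiE[symmetric]) auto
  also have "\<dots> = 1" by (simp add: st)
  finally show ?thesis .
qed

lemma psd_on_diagonal: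
  assumes "finite S" "\<And>u. u \<in> S \<Longrightarrow> 0 \<le> w u"
  shows "psd_on S (\<lambda>u v. if u = v then w u else 0)"
  unfolding psd_on_def
proof
  fix \<psi> :: "'a \<Rightarrow> complex"
  have "(\<Sum>u\<in>S. \<Sum>v\<in>S. cnj (\<psi> u) * (if u = v then w u else 0) * \<psi> v)
      = (\<Sum>u\<in>S. \<Sum>v\<in>S. if u = v then w u * (cnj (\<psi> u) * \<psi> u) else 0)"
    by (intro sum.cong refl) (simp add: mult_ac)
  also have "\<dots> = (\<Sum>u\<in>S. w u * (cnj (\<psi> u) * \<psi> u))"
    using assms(1) by simp
  also have "\<dots> \<ge> 0"
    by (intro sum_nonneg mult_nonneg_nonneg assms cnj_mult_self_nonneg)
  finally show "0 \<le> (\<Sum>u\<in>S. \<Sum>v\<in>S. cnj (\<psi> u) * (if u = v then w u else 0) * \<psi> v)" .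
qed

lemma drop_k_PiE: "a \<in> PiE {..<N} A \<Longrightarrow> drop_k N k a \<in> PiE ({..<N} - {k}) A"
  by (auto simp: drop_k_def PiE_def Pi_def)

lemma drop_k_upd:
  assumes "c \<in> PiE ({..<N} - {k}) A"
  shows "drop_k N k (c(k := y)) = c"
  using assms by (auto simp: drop_k_def fun_eq_iff PiE_def extensional_def restrict_def)

lemma upd_PiE:
  assumes "c \<in> PiE ({..<N} - {k}) A" "y \<in> A k" "k < N"
  shows "c(k := y) \<in> PiE {..<N} A"
  using assms by (auto simp: PiE_def Pi_def extensional_def)

lemma upd_drop_k:
  assumes "a \<in> PiE {..<N} A" "k < N"
  shows "(drop_k N k a)(k := a k) = a"
  using assms by (auto simp: drop_k_def fun_eq_iff PiE_def extensional_def restrict_def)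

lemma choi_correlation_of_process_function:
  fixes N :: nat and A :: "nat \<Rightarrow> 'a set" and X :: "nat \<Rightarrow> 'x set"
    and f :: "nat \<Rightarrow> (nat \<Rightarrow> 'a) \<Rightarrow> 'x" and g :: "nat \<Rightarrow> (nat \<Rightarrow> 'a) \<Rightarrow> 'b"
  assumes A: "\<forall>k<N. finite (A k) \<and> A k \<noteq> {}"
    and X: "\<forall>k<N. finite (X k)"
    and f: "\<forall>k<N. \<forall>a\<in>PiE {..<N} A. f k a \<in> X k"
    and pf: "process_function N A (\<lambda>k. g k ` PiE ({..<N} - {k}) A) (\<lambda>a. \<lambda>k\<in>{..<N}. g k (drop_k N k a))"
    and f': "\<forall>k<N. \<forall>a\<in>PiE {..<N} A. f k a = f' k (a k) (g k (drop_k N k a))"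
  shows "\<exists>dI dO W C. choi_correlation N A X (\<lambda>a x. if \<forall>k<N. x k = f k a then 1 else 0) dI dO W C"
proof -
  define B where "B = (\<lambda>k. g k ` PiE ({..<N} - {k}) A)"
  define G where "G = (\<lambda>a. \<lambda>k\<in>{..<N}. g k (drop_k N k a))"
  have pf: "process_function N A B G" using pf by (simp add: B_def G_def)
  have GB: "G a k \<in> B k" if "a \<in> PiE {..<N} A" "k < N" for a k
    using that by (auto simp: G_def B_def intro!: drop_k_PiE)
  have finA: "finite (A k)" and neA: "A k \<noteq> {}" if "k < N" for k using A that by auto
  have finPi: "finite (PiE {..<N} A)" using finA by (intro finite_PiE) auto
  have finB: "finite (B k)" and neB: "B k \<noteq> {}" for k
    using A by (auto simp: B_def PiE_eq_empty_iff intro!: finite_imageI finite_PiE)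
  define dI where "dI = (\<lambda>k. card (B k))"
  define dO where "dO = (\<lambda>k. card (A k))"
  have "\<forall>k. \<exists>\<alpha>. k < N \<longrightarrow> bij_betw \<alpha> {..<dO k} (A k)"
    using ex_bij_betw_nat_finite finA unfolding dO_def atLeast0LessThan by blast
  from choice[OF this] obtain \<alpha> where \<alpha>: "\<And>k. k < N \<Longrightarrow> bij_betw (\<alpha> k) {..<dO k} (A k)" by blast
  have "\<forall>k. \<exists>\<beta>. bij_betw \<beta> {..<dI k} (B k)"
    using ex_bij_betw_nat_finite finB unfolding dI_def atLeast0LessThan by blast
  from choice[OF this] obtain \<beta> where \<beta>: "\<And>k. bij_betw (\<beta> k) {..<dI k} (B k)" by blast
  define \<alpha>' where "\<alpha>' = (\<lambda>k. inv_into {..<dO k} (\<alpha> k))"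
  define \<beta>' where "\<beta>' = (\<lambda>k. inv_into {..<dI k} (\<beta> k))"
  have \<alpha>1: "\<alpha> k r \<in> A k" "\<alpha>' k (\<alpha> k r) = r" if "k < N" "r < dO k" for k r
    using \<alpha>[OF that(1)] that(2) by (auto simp: bij_betw_def \<alpha>'_def)
  have \<alpha>2: "\<alpha>' k y < dO k" "\<alpha> k (\<alpha>' k y) = y" if "k < N" "y \<in> A k" for k y
    using \<alpha>[OF that(1)] that(2) inv_into_into[of y "\<alpha> k" "{..<dO k}"]
    by (auto simp: bij_betw_def \<alpha>'_def f_inv_into_f)
  have \<beta>1: "\<beta> k r \<in> B k" "\<beta>' k (\<beta> k r) = r" if "r < dI k" for k r
    using \<beta>[of k] that by (auto simp: bij_betw_def \<beta>'_def)
  have \<beta>2: "\<beta>' k y < dI k" "\<beta> k (\<beta>' k y) = y" if "y \<in> B k" for k y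
    using \<beta>[of k] that inv_into_into[of y "\<beta> k" "{..<dI k}"]
    by (auto simp: bij_betw_def \<beta>'_def f_inv_into_f)
  \<comment> \<open>Every element of \<open>B k\<close> is an attained label, so \<open>f'\<close>
    at it is a value of \<open>f\<close>.\<close>
  have f'X: "f' k y b \<in> X k" if k: "k < N" and y: "y \<in> A k" and b: "b \<in> B k" for k y b
  proof -
    obtain c where c: "c \<in> PiE ({..<N} - {k}) A" "b = g k c" using b by (auto simp: B_def)
    have cy: "c(k := y) \<in> PiE {..<N} A" by (rule upd_PiE[OF c(1) y k])
    have "f k (c(k := y)) = f' k ((c(k := y)) k) (g k (drop_k N k (c(k := y))))"
      using f' k cy by blast
    then have "f k (c(k := y)) = f' k y b" using drop_k_upd[OF c(1)] c(2) by simp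
    moreover have "f k (c(k := y)) \<in> X k" using f k cy by blast
    ultimately show ?thesis by simp
  qed

  \<comment> \<open>\<open>\<tau>\<close> reads the settings from the output basis states,
    \<open>\<upsilon>\<close> sends settings to the basis vector on the graph of \<open>G\<close>,
    and \<open>supp\<close> says that a basis vector lies on that graph.\<close>
  define \<tau> where "\<tau> = (\<lambda>u::nat \<Rightarrow> nat \<times> nat. \<lambda>k\<in>{..<N}. \<alpha> k (snd (u k)))"
  define \<upsilon> where "\<upsilon> = (\<lambda>a. \<lambda>k\<in>{..<N}. (\<beta>' k (G a k), \<alpha>' k (a k)))"
  define supp where "supp = (\<lambda>u::nat \<Rightarrow> nat \<times> nat. \<forall>k<N. \<beta> k (fst (u k)) = G (\<tau> u) k)"
  define W :: "(nat \<Rightarrow> nat \<times> nat) cmat" where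
    "W = (\<lambda>u v. if u = v then (if supp u then 1 else 0) else 0)"
  \<comment> \<open>The party reads its label in the standard basis, reports the value of
    \<open>f'\<close>, and emits the basis state of its own setting.\<close>
  define C :: "nat \<Rightarrow> 'a \<Rightarrow> 'x \<Rightarrow> (nat \<times> nat) cmat" where
    "C = (\<lambda>k a x u v. if u = v then (if \<alpha> k (snd u) = a \<and> x = f' k a (\<beta> k (fst u)) then 1 else 0) else 0)"

  \<comment> \<open>On the support of \<open>W\<close> the outputs determine the inputs, so the
    trace is a sum over setting tuples that sees only diagonal entries of \<open>M\<close>.\<close>
  have tr: "tr_prod N dI dO W M = (\<Sum>a\<in>PiE {..<N} A. \<Prod>k<N. M k (\<beta>' k (G a k), \<alpha>' k (a k)) (\<beta>' k (G a k), \<alpha>' k (a k)))"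
    for M
  proof -
    have "tr_prod N dI dO W M = (\<Sum>u\<in>pm_basis N dI dO. \<Sum>v\<in>pm_basis N dI dO.
        if u = v then (if supp u then \<Prod>k<N. M k (u k) (u k) else 0) else 0)"
      unfolding tr_prod_def W_def by (intro sum.cong refl) auto
    also have "\<dots> = (\<Sum>u\<in>pm_basis N dI dO. if supp u then \<Prod>k<N. M k (u k) (u k) else 0)"
      by simp
    also have "\<dots> = (\<Sum>u\<in>{u\<in>pm_basis N dI dO. supp u}. \<Prod>k<N. M k (u k) (u k))"
      by (rule sum.inter_filter[symmetric]) simp
    also have "\<dots> = (\<Sum>a\<in>PiE {..<N} A. \<Prod>k<N. M k (\<upsilon> a k) (\<upsilon> a k))"
    proof (rule sum.reindex_bij_witness[of _ \<upsilon> \<tau>])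
      fix a assume a: "a \<in> PiE {..<N} A"
      show ta: "\<tau> (\<upsilon> a) = a"
        using a \<alpha>2 by (auto simp: \<tau>_def \<upsilon>_def fun_eq_iff PiE_def Pi_def extensional_def restrict_def)
      have "\<upsilon> a \<in> pm_basis N dI dO"
        using a GB[OF a] \<alpha>2 \<beta>2 by (auto simp: \<upsilon>_def pm_basis_def)
      moreover have "supp (\<upsilon> a)"
        unfolding supp_def ta using GB[OF a] \<beta>2 by (auto simp: \<upsilon>_def)
      ultimately show "\<upsilon> a \<in> {u\<in>pm_basis N dI dO. supp u}" by simp
    next
      fix u assume "u \<in> {u\<in>pm_basis N dI dO. supp u}"
      then have u: "u \<in> pm_basis N dI dO" "supp u" by auto
      have uk: "fst (u k) < dI k" "snd (u k) < dO k" if "k < N" for k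
        using pm_basis_cell[OF u(1) that] by auto
      show "\<upsilon> (\<tau> u) = u"
      proof
        fix k
        show "\<upsilon> (\<tau> u) k = u k"
        proof (cases "k < N")
          case True
          have "G (\<tau> u) k = \<beta> k (fst (u k))" using u(2) True by (simp add: supp_def)
          then show ?thesis using True uk[OF True] \<alpha>1 \<beta>1 by (simp add: \<upsilon>_def) (simp add: \<tau>_def)
        next
          case False
          then show ?thesis using u(1) by (auto simp: \<upsilon>_def pm_basis_def PiE_def extensional_def)
        qed
      qed
      then show "(\<Prod>k<N. M k (\<upsilon> (\<tau> u) k) (\<upsilon> (\<tau> u) k)) = (\<Prod>k<N. M k (u k) (u k))" by simp
      show "\<tau> u \<in> PiE {..<N} A" using uk \<alpha>1 by (auto simp: \<tau>_def)
    qed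
    also have "\<dots> = (\<Sum>a\<in>PiE {..<N} A. \<Prod>k<N. M k (\<beta>' k (G a k), \<alpha>' k (a k)) (\<beta>' k (G a k), \<alpha>' k (a k)))"
      by (intro sum.cong prod.cong refl) (auto simp: \<upsilon>_def)
    finally show ?thesis .
  qed

  have "choi_correlation N A X (\<lambda>a x. if \<forall>k<N. x k = f k a then 1 else 0) dI dO W C"
    unfolding choi_correlation_def
  proof (intro conjI allI impI ballI)
    fix k assume k: "k < N"
    show "0 < dI k" using finB neB by (simp add: dI_def card_gt_0_iff)
    show "0 < dO k" using finA[OF k] neA[OF k] by (simp add: dO_def card_gt_0_iff)
  next
    show "psd_on (pm_basis N dI dO) W"
      unfolding W_def by (rule psd_on_diagonal) (auto simp: less_eq_complex_def)
  next
    fix D assume D: "\<forall>k<N. chan (dI k) (dO k) (D k)"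
    \<comment> \<open>The diagonal of a channel is a stochastic matrix from labels to settings, so
      the classical normalisation applies.\<close>
    define P where "P = (\<lambda>k b y. D k (\<beta>' k b, \<alpha>' k y) (\<beta>' k b, \<alpha>' k y))"
    have "(\<Sum>y\<in>A k. P k b y) = 1" if k: "k < N" and b: "b \<in> B k" for k b
    proof -
      have "(\<Sum>y\<in>A k. P k b y) = (\<Sum>r<dO k. P k b (\<alpha> k r))"
        by (rule sum.reindex_bij_betw[OF \<alpha>[OF k], symmetric])
      also have "\<dots> = (\<Sum>r<dO k. D k (\<beta>' k b, r) (\<beta>' k b, r))"
        using \<alpha>1 k by (simp add: P_def)
      also have "\<dots> = 1" using D k \<beta>2[OF b] by (simp add: chan_def)
      finally show ?thesis .
    qed
    then have "(\<Sum>a\<in>PiE {..<N} A. \<Prod>k<N. P k (G a k) (a k)) = 1"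
      by (intro process_function_stochastic[OF pf] finA finB)
    then show "tr_prod N dI dO W D = 1" by (simp add: tr P_def)
  next
    fix k a x assume "k < N" "a \<in> A k" "x \<in> X k"
    show "psd_on (cell (dI k) (dO k)) (C k a x)"
      unfolding C_def by (rule psd_on_diagonal) (auto simp: less_eq_complex_def)
  next
    fix k a assume k: "k < N" and a: "a \<in> A k"
    show "chan (dI k) (dO k) (\<lambda>u v. \<Sum>x\<in>X k. C k a x u v)"
      unfolding chan_def
    proof (intro conjI allI impI)
      show "psd_on (cell (dI k) (dO k)) (\<lambda>u v. \<Sum>x\<in>X k. C k a x u v)"
        by (rule psd_on_sum) (unfold C_def, rule psd_on_diagonal, auto simp: less_eq_complex_def)
      fix j j' assume j: "j < dI k" "j' < dI k"
      have fx: "f' k a (\<beta> k j) \<in> X k" by (rule f'X[OF k a \<beta>1(1)[OF j(1)]])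
      have "(\<Sum>r<dO k. \<Sum>x\<in>X k. C k a x (j, r) (j', r))
          = (\<Sum>r<dO k. \<Sum>x\<in>X k. if x = f' k a (\<beta> k j) then (if r = \<alpha>' k a then (if j = j' then 1 else 0) else 0) else 0)"
        using \<alpha>1 \<alpha>2 k a by (intro sum.cong refl) (auto simp: C_def)
      also have "\<dots> = (if j = j' then 1 else 0)"
        using fx X k \<alpha>2(1)[OF k a] by simp
      finally show "(\<Sum>r<dO k. \<Sum>x\<in>X k. C k a x (j, r) (j', r)) = (if j = j' then 1 else 0)" .
    qed
  next
    fix a x assume a: "a \<in> PiE {..<N} A" and x: "x \<in> PiE {..<N} X"
    have "tr_prod N dI dO W (\<lambda>k. C k (a k) (x k))
        = (\<Sum>b\<in>PiE {..<N} A. \<Prod>k<N. if b k = a k \<and> x k = f' k (a k) (G b k) then 1 else 0)"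
      unfolding tr using \<alpha>2 \<beta>2 GB
      by (intro sum.cong prod.cong refl) (auto simp: C_def PiE_def Pi_def)
    also have "\<dots> = (\<Sum>b\<in>PiE {..<N} A. if b = a then (if \<forall>k<N. x k = f k a then 1 else 0) else 0)"
    proof (rule sum.cong[OF refl])
      fix b assume b: "b \<in> PiE {..<N} A"
      have ba: "b = a \<longleftrightarrow> (\<forall>k<N. b k = a k)"
        using a b by (auto intro: PiE_ext)
      have "f k a = f' k (a k) (G a k)" if "k < N" for k
        using f' a that by (simp add: G_def)
      then show "(\<Prod>k<N. if b k = a k \<and> x k = f' k (a k) (G b k) then 1 else 0)
          = (if b = a then (if \<forall>k<N. x k = f k a then 1 else 0) else (0::complex))"
        using ba by (auto simp: prod_if_zero)
    qed
    also have "\<dots> = (if \<forall>k<N. x k = f k a then 1 else 0)"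
      using a finPi by simp
    finally show "complex_of_real (if \<forall>k<N. x k = f k a then 1 else 0) = tr_prod N dI dO W (\<lambda>k. C k (a k) (x k))"
      by simp
  qed
  then show ?thesis by blast
qed

subsection \<open>From process matrices to process functions\<close>

definition projector :: "nat \<Rightarrow> nat cmat \<Rightarrow> bool" where
  "projector d P \<longleftrightarrow> (\<forall>i j. cnj (P i j) = P j i) \<and>
     (\<forall>i<d. \<forall>j<d. (\<Sum>l<d. P i l * P l j) = P i j)"

lemma projector_cnj: "projector d P \<Longrightarrow> cnj (P i j) = P j i"
  by (simp add: projector_def)

text \<open>Gram-Schmidt, one row \<open>r l\<close> at a time: the range of \<open>P\<close> is cut
  down by the direction in it that the new row still detects.\<close>

lemma exists_kernel_projector:
  fixes r :: "'l \<Rightarrow> nat \<Rightarrow> complex"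
  assumes "finite I"
  shows "\<exists>P. projector d P \<and> (\<forall>l\<in>I. \<forall>i<d. (\<Sum>j<d. r l j * P j i) = 0) \<and>
     (\<forall>u. (\<forall>l\<in>I. (\<Sum>j<d. r l j * u j) = 0) \<longrightarrow> (\<forall>i<d. (\<Sum>j<d. P i j * u j) = u i))"
  using assms
proof (induction I rule: finite_induct)
  case empty
  have "(if a then 1 else 0) * (b::complex) = (if a then b else 0)" for a b by simp
  then show ?case
    by (intro exI[of _ "\<lambda>i j. if i = j then 1 else 0"]) (auto simp: projector_def)
next
  case (insert l I)
  from insert.IH obtain P where IH: "projector d P \<and> (\<forall>l\<in>I. \<forall>i<d. (\<Sum>j<d. r l j * P j i) = 0) \<and>
     (\<forall>u. (\<forall>l\<in>I. (\<Sum>j<d. r l j * u j) = 0) \<longrightarrow> (\<forall>i<d. (\<Sum>j<d. P i j * u j) = u i))" ..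
  note P = IH[THEN conjunct1] and kill = IH[THEN conjunct2, THEN conjunct1, rule_format]
    and fix_u = IH[THEN conjunct2, THEN conjunct2, rule_format]
  note cP = projector_cnj[OF P]
  have idem: "(\<Sum>l<d. P i l * P l j) = P i j" if "i < d" "j < d" for i j
    using P that by (simp add: projector_def)
  \<comment> \<open>The part of the new row that is visible on the range of \<open>P\<close>; its
    conjugate lies in that range, and \<open>n\<close> is its squared norm.\<close>
  define t where "t = (\<lambda>i. \<Sum>j<d. r l j * P j i)"
  define n where "n = (\<Sum>i<d. t i * cnj (t i))"
  have tP: "(\<Sum>i<d. t i * P i j) = t j" if "j < d" for j
  proof -
    have "(\<Sum>i<d. t i * P i j) = (\<Sum>m<d. r l m * (\<Sum>i<d. P m i * P i j))"
      unfolding t_def sum_distrib_left sum_distrib_right by (subst sum.swap) (simp add: mult.assoc)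
    then show ?thesis using that by (simp add: t_def idem)
  qed
  have Pt: "(\<Sum>j<d. P i j * cnj (t j)) = cnj (t i)" if "i < d" for i
    using arg_cong[OF tP[OF that], of cnj] by (simp add: cP mult.commute)
  have tu: "(\<Sum>i<d. t i * u i) = (\<Sum>j<d. r l j * (\<Sum>i<d. P j i * u i))" for u
    unfolding t_def sum_distrib_left sum_distrib_right by (subst sum.swap) (simp add: mult.assoc)
  have ut: "(\<Sum>j<d. r l' j * cnj (t j)) = 0" if "l' \<in> I" for l'
  proof -
    have "(\<Sum>j<d. r l' j * cnj (t j)) = (\<Sum>j<d. r l' j * (\<Sum>i<d. P j i * cnj (t i)))"
      by (intro sum.cong refl) (simp add: Pt)
    also have "\<dots> = (\<Sum>i<d. (\<Sum>j<d. r l' j * P j i) * cnj (t i))"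
      unfolding sum_distrib_left sum_distrib_right by (subst sum.swap) (simp add: mult.assoc)
    also have "\<dots> = 0" using kill[OF that] by simp
    finally show ?thesis .
  qed
  have rt: "(\<Sum>j<d. r l j * cnj (t j)) = n"
  proof -
    have "(\<Sum>j<d. r l j * cnj (t j)) = (\<Sum>j<d. r l j * (\<Sum>i<d. P j i * cnj (t i)))"
      by (intro sum.cong refl) (simp add: Pt)
    then show ?thesis unfolding n_def tu by simp
  qed
  show ?case
  proof (cases "n = 0")
    case True
    have "t i = 0" if "i < d" for i
    proof -
      have "\<forall>i\<in>{..<d}. t i * cnj (t i) = 0"
        using True unfolding n_def
        by (subst sum_nonneg_eq_0_iff[symmetric]) (simp_all add: less_eq_complex_def)
      then show ?thesis using that by simp
    qed
    then have "(\<Sum>j<d. r l j * P j i) = 0" if "i < d" for i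
      using that by (simp add: t_def)
    then show ?thesis using IH by (intro exI[of _ P]) simp
  next
    case False
    have cn: "cnj n = n" by (simp add: n_def mult.commute)
    \<comment> \<open>Removes from \<open>P\<close> the rank-one projector onto the direction
      \<open>cnj t\<close>; vectors killed by the new row are orthogonal to it and stay
      fixed.\<close>
    define Q where "Q = (\<lambda>i j. P i j - cnj (t i) * t j / n)"
    have Qu: "(\<Sum>j<d. Q i j * u j) = (\<Sum>j<d. P i j * u j) - cnj (t i) * (\<Sum>j<d. t j * u j) / n" for i u
      by (simp add: Q_def sum_subtractf sum_distrib_left sum_divide_distrib algebra_simps)
    have rQ: "(\<Sum>j<d. s j * Q j i) = (\<Sum>j<d. s j * P j i) - (\<Sum>j<d. s j * cnj (t j)) * t i / n" for i s
      by (simp add: Q_def sum_subtractf sum_distrib_left sum_distrib_right sum_divide_distrib algebra_simps)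
    have tt: "(\<Sum>j<d. t j * cnj (t j)) = n" by (simp add: n_def)
    have tQ: "(\<Sum>j<d. t j * Q j i) = 0" if "i < d" for i
      using False that by (simp add: rQ tP tt)
    have "projector d Q"
      unfolding projector_def
    proof (intro conjI allI impI)
      show "cnj (Q i j) = Q j i" for i j by (simp add: Q_def cP cn mult.commute)
      show "(\<Sum>m<d. Q i m * Q m j) = Q i j" if "i < d" "j < d" for i j
      proof -
        have "(\<Sum>m<d. Q i m * Q m j) = (\<Sum>m<d. P i m * Q m j)"
          using that by (simp add: Qu tQ)
        also have "\<dots> = Q i j" using that by (simp add: rQ idem Pt) (simp add: Q_def)
        finally show ?thesis .
      qed
    qed
    moreover have "(\<Sum>j<d. r l' j * Q j i) = 0" if "l' \<in> insert l I" "i < d" for l' i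
      using that kill ut rt False by (auto simp: rQ) (simp add: t_def)
    moreover have "(\<Sum>j<d. Q i j * u j) = u i"
      if u: "\<forall>l\<in>insert l I. (\<Sum>j<d. r l j * u j) = 0" and "i < d" for u i
    proof -
      have Pu: "(\<Sum>j<d. P i j * u j) = u i" if "i < d" for i
        by (rule fix_u) (use u that in auto)
      have "(\<Sum>j<d. t j * u j) = 0" using u unfolding tu by (simp add: Pu)
      then show ?thesis using Pu \<open>i < d\<close> by (simp add: Qu)
    qed
    ultimately show ?thesis by (intro exI[of _ Q]) blast
  qed
qed

definition projective_measurement :: "nat \<Rightarrow> 'c set \<Rightarrow> ('c \<Rightarrow> nat cmat) \<Rightarrow> bool" where
  "projective_measurement d S P \<longleftrightarrow> finite S \<and> (\<forall>c\<in>S. \<forall>i j. cnj (P c i j) = P c j i) \<and>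
     (\<forall>c\<in>S. \<forall>c'\<in>S. \<forall>i<d. \<forall>j<d. (\<Sum>l<d. P c i l * P c' l j) = (if c = c' then P c i j else 0)) \<and>
     (\<forall>i<d. \<forall>j<d. (\<Sum>c\<in>S. P c i j) = (if i = j then 1 else 0))"

lemma
  assumes "projective_measurement d S P"
  shows projective_measurement_finite: "finite S"
    and projective_measurement_cnj: "\<And>c i j. c \<in> S \<Longrightarrow> cnj (P c i j) = P c j i"
    and projective_measurement_orth: "\<And>c c' i j. c \<in> S \<Longrightarrow> c' \<in> S \<Longrightarrow> i < d \<Longrightarrow> j < d \<Longrightarrow>
      (\<Sum>l<d. P c i l * P c' l j) = (if c = c' then P c i j else 0)"
    and projective_measurement_sum: "\<And>i j. i < d \<Longrightarrow> j < d \<Longrightarrow> (\<Sum>c\<in>S. P c i j) = (if i = j then 1 else 0)"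
  using assms by (auto simp: projective_measurement_def)

text \<open>Each label \<open>b\<close> gets the common kernel of the effects it excludes; two labels are told apart by
  some setting, whose effects sum to the identity, so their kernels are orthogonal. \<open>None\<close> collects
  the orthogonal complement.\<close>
lemma exists_label_measurement:
  fixes E :: "'a \<Rightarrow> 'x \<Rightarrow> nat cmat" and \<phi> :: "'a \<Rightarrow> 'b \<Rightarrow> 'x"
  assumes fin: "finite A" "finite X" "finite B"
    and herm: "\<And>a x i j. a \<in> A \<Longrightarrow> x \<in> X \<Longrightarrow> i < d \<Longrightarrow> j < d \<Longrightarrow> cnj (E a x i j) = E a x j i"
    and total: "\<And>a i j. a \<in> A \<Longrightarrow> i < d \<Longrightarrow> j < d \<Longrightarrow> (\<Sum>x\<in>X. E a x i j) = (if i = j then 1 else 0)"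
    and \<phi>: "\<And>a b. a \<in> A \<Longrightarrow> b \<in> B \<Longrightarrow> \<phi> a b \<in> X"
    and sep: "\<And>b b'. b \<in> B \<Longrightarrow> b' \<in> B \<Longrightarrow> b \<noteq> b' \<Longrightarrow> \<exists>a\<in>A. \<phi> a b \<noteq> \<phi> a b'"
  shows "\<exists>P. projective_measurement d (insert None (Some ` B)) P \<and>
     (\<forall>b\<in>B. \<forall>u. (\<forall>a\<in>A. \<forall>x\<in>X. x \<noteq> \<phi> a b \<longrightarrow> (\<forall>i<d. (\<Sum>j<d. E a x i j * u j) = 0)) \<longrightarrow>
        (\<forall>i<d. (\<Sum>j<d. P (Some b) i j * u j) = u i))"
proof -
  define I where "I = (\<lambda>b. {(a, x, i). a \<in> A \<and> x \<in> X \<and> x \<noteq> \<phi> a b \<and> i < d})"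
  have finI: "finite (I b)" for b
    by (rule finite_subset[of _ "A \<times> X \<times> {..<d}"]) (use fin in \<open>auto simp: I_def\<close>)
  have "\<forall>b. \<exists>P. projector d P \<and> (\<forall>a\<in>A. \<forall>x\<in>X. x \<noteq> \<phi> a b \<longrightarrow> (\<forall>i<d. \<forall>j<d. (\<Sum>m<d. E a x i m * P m j) = 0)) \<and>
     (\<forall>u. (\<forall>a\<in>A. \<forall>x\<in>X. x \<noteq> \<phi> a b \<longrightarrow> (\<forall>i<d. (\<Sum>j<d. E a x i j * u j) = 0)) \<longrightarrow>
        (\<forall>i<d. (\<Sum>j<d. P i j * u j) = u i))"
  proof
    fix b
    show "\<exists>P. projector d P \<and> (\<forall>a\<in>A. \<forall>x\<in>X. x \<noteq> \<phi> a b \<longrightarrow> (\<forall>i<d. \<forall>j<d. (\<Sum>m<d. E a x i m * P m j) = 0)) \<and>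
     (\<forall>u. (\<forall>a\<in>A. \<forall>x\<in>X. x \<noteq> \<phi> a b \<longrightarrow> (\<forall>i<d. (\<Sum>j<d. E a x i j * u j) = 0)) \<longrightarrow>
        (\<forall>i<d. (\<Sum>j<d. P i j * u j) = u i))"
      using exists_kernel_projector[OF finI[of b], where d = d and r = "\<lambda>(a, x, i). E a x i"]
      by (simp add: I_def Ball_def imp_conjL)
  qed
  from choice[OF this] obtain R where
    R0: "\<forall>b. projector d (R b) \<and> (\<forall>a\<in>A. \<forall>x\<in>X. x \<noteq> \<phi> a b \<longrightarrow> (\<forall>i<d. \<forall>j<d. (\<Sum>m<d. E a x i m * R b m j) = 0)) \<and>
     (\<forall>u. (\<forall>a\<in>A. \<forall>x\<in>X. x \<noteq> \<phi> a b \<longrightarrow> (\<forall>i<d. (\<Sum>j<d. E a x i j * u j) = 0)) \<longrightarrow>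
        (\<forall>i<d. (\<Sum>j<d. R b i j * u j) = u i))" ..
  note R = R0[THEN spec, THEN conjunct1]
    and kill = R0[THEN spec, THEN conjunct2, THEN conjunct1, rule_format]
  note cR = projector_cnj[OF R]
  have idem: "(\<Sum>m<d. R b i m * R b m j) = R b i j" if "i < d" "j < d" for b i j
    using R that by (simp add: projector_def)
  have orth: "(\<Sum>m<d. R b' i m * R b m j) = 0"
    if b: "b \<in> B" "b' \<in> B" "b \<noteq> b'" and ij: "i < d" "j < d" for b b' i j
  proof -
    obtain a where a: "a \<in> A" "\<phi> a b \<noteq> \<phi> a b'" using sep[OF b] by blast
    \<comment> \<open>On the range of \<open>R b\<close> all other effects of setting
      \<open>a\<close> vanish, so the effect of \<open>?x\<close> acts there as the identity
      (\<open>ER\<close>). For \<open>b'\<close> the outcome \<open>?x\<close> is excluded, so the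
      same effect annihilates the range of \<open>R b'\<close> (\<open>RE\<close>).\<close>
    let ?x = "\<phi> a b"
    have ER: "R b m j = (\<Sum>l<d. E a ?x m l * R b l j)" if "m < d" for m
    proof -
      have "R b m j = (\<Sum>l<d. (if m = l then 1 else 0) * R b l j)"
        using that by (simp add: if_distrib[of "\<lambda>z. z * _"] cong: if_cong)
      also have "\<dots> = (\<Sum>l<d. \<Sum>x\<in>X. E a x m l * R b l j)"
        using that total[OF a(1)] by (intro sum.cong refl) (simp flip: sum_distrib_right)
      also have "\<dots> = (\<Sum>x\<in>X. if x = ?x then \<Sum>l<d. E a ?x m l * R b l j else 0)"
        by (subst sum.swap, intro sum.cong refl) (use kill a that ij in auto)
      also have "\<dots> = (\<Sum>l<d. E a ?x m l * R b l j)"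
        using fin \<phi>[OF a(1) b(1)] by simp
      finally show ?thesis .
    qed
    have RE: "(\<Sum>m<d. R b' i m * E a ?x m l) = 0" if l: "l < d" for l
    proof -
      have "(\<Sum>m<d. R b' i m * E a ?x m l) = cnj (\<Sum>m<d. E a ?x l m * R b' m i)"
        unfolding cnj_sum complex_cnj_mult cR using herm[OF a(1) \<phi>[OF a(1) b(1)]] l
        by (intro sum.cong refl) (simp add: mult.commute)
      also have "(\<Sum>m<d. E a ?x l m * R b' m i) = 0"
        using kill[OF a(1) \<phi>[OF a(1) b(1)] a(2) l ij(1)] .
      finally show ?thesis by simp
    qed
    have "(\<Sum>m<d. R b' i m * R b m j) = (\<Sum>m<d. R b' i m * (\<Sum>l<d. E a ?x m l * R b l j))"
      by (intro sum.cong refl) (use ER in auto)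
    also have "\<dots> = (\<Sum>l<d. (\<Sum>m<d. R b' i m * E a ?x m l) * R b l j)"
      unfolding sum_distrib_left sum_distrib_right by (subst sum.swap) (simp add: mult.assoc)
    also have "\<dots> = 0" using RE by simp
    finally show ?thesis .
  qed
  define Rs where "Rs = (\<lambda>i j. \<Sum>b\<in>B. R b i j)"
  define P where "P = (\<lambda>c i j. case c of Some b \<Rightarrow> R b i j | None \<Rightarrow> (if i = j then 1 else 0) - Rs i j)"
  have RsR: "(\<Sum>m<d. Rs i m * R b m j) = R b i j" if "b \<in> B" "i < d" "j < d" for b i j
  proof -
    have "(\<Sum>m<d. Rs i m * R b m j) = (\<Sum>b'\<in>B. \<Sum>m<d. R b' i m * R b m j)"
      unfolding Rs_def sum_distrib_right by (rule sum.swap)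
    also have "\<dots> = (\<Sum>b'\<in>B. if b' = b then R b i j else 0)"
      using that orth idem by (intro sum.cong refl) auto
    also have "\<dots> = R b i j" using fin that by simp
    finally show ?thesis .
  qed
  have cRs: "cnj (Rs i j) = Rs j i" for i j by (simp add: Rs_def cR)
  have RRs: "(\<Sum>m<d. R b i m * Rs m j) = R b i j" if "b \<in> B" "i < d" "j < d" for b i j
    using arg_cong[OF RsR[OF that(1,3,2)], of cnj] by (simp add: cR cRs mult.commute)
  have RsRs: "(\<Sum>m<d. Rs i m * Rs m j) = Rs i j" if "i < d" "j < d" for i j
  proof -
    have "(\<Sum>m<d. Rs i m * Rs m j) = (\<Sum>b\<in>B. \<Sum>m<d. R b i m * Rs m j)"
      unfolding fun_cong[OF fun_cong[OF Rs_def], of i] sum_distrib_right by (rule sum.swap)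
    then show ?thesis using that RRs by (simp add: Rs_def)
  qed
  have delta: "(if p then 1 else 0) * (z::complex) = (if p then z else 0)"
    "z * (if p then 1 else 0) = (if p then z else 0)" for p z by auto
  have "projective_measurement d (insert None (Some ` B)) P"
    unfolding projective_measurement_def
  proof (intro conjI ballI allI impI)
    show "finite (insert None (Some ` B))" using fin by simp
    show "cnj (P c i j) = P c j i" for c i j
      by (auto simp: P_def cR cRs split: option.split)
    show "(\<Sum>l<d. P c i l * P c' l j) = (if c = c' then P c i j else 0)"
      if H: "c \<in> insert None (Some ` B)" "c' \<in> insert None (Some ` B)" "i < d" "j < d" for c c' i j
    proof (cases "c = c'")
      case True
      then show ?thesis using H
        by (auto simp: P_def left_diff_distrib right_diff_distrib sum_subtractf delta RsRs idem)
    next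
      case False
      then consider b where "b \<in> B" "c = None" "c' = Some b" | b where "b \<in> B" "c = Some b" "c' = None"
        | b b' where "b \<in> B" "b' \<in> B" "b \<noteq> b'" "c = Some b'" "c' = Some b"
        using H by auto
      then show ?thesis
        by cases (use H in \<open>simp_all add: P_def left_diff_distrib right_diff_distrib sum_subtractf delta RsR RRs orth\<close>)
    qed
    show "(\<Sum>c\<in>insert None (Some ` B). P c i j) = (if i = j then 1 else 0)" for i j
      using fin by (subst sum.insert) (auto simp: sum.reindex P_def Rs_def)
  qed
  moreover have "P (Some b) = R b" for b by (simp add: P_def)
  ultimately show ?thesis using R0 by (intro exI[of _ P]) simp
qed

section \<open>Effects, sub-channels and compression of the input\<close>

text \<open>The POVM element on the input space, obtained by tracing out the output.\<close>

definition effect :: "nat \<Rightarrow> (nat \<times> nat) cmat \<Rightarrow> nat cmat" where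
  "effect e C = (\<lambda>j j'. \<Sum>r<e. C (j, r) (j', r))"

text \<open>Trace-non-increasing maps. The remainder is part of the notion because normalisation can
  be applied only after completion to a channel.\<close>

definition subchan :: "nat \<Rightarrow> nat \<Rightarrow> (nat \<times> nat) cmat \<Rightarrow> bool" where
  "subchan d e C \<longleftrightarrow> psd_on (cell d e) C \<and>
     (\<exists>L. psd_on (cell d e) L \<and> chan d e (\<lambda>u v. C u v + L u v))"

text \<open>Compression of the input space. The two sides may differ, so that blocks between
  different measurement results are expressible too.\<close>

definition sand :: "nat \<Rightarrow> nat cmat \<Rightarrow> nat cmat \<Rightarrow> (nat \<times> nat) cmat \<Rightarrow> (nat \<times> nat) cmat" where
  "sand d P Q C = (\<lambda>(j, r) (j', r'). \<Sum>i<d. \<Sum>i'<d. P j i * C (i, r) (i', r') * Q i' j')"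

lemma chan_effect: "chan d e C \<Longrightarrow> j < d \<Longrightarrow> j' < d \<Longrightarrow> effect e C j j' = (if j = j' then 1 else 0)"
  by (simp add: chan_def effect_def)

lemma chanI:
  assumes "psd_on (cell d e) C"
    and "\<And>j j'. j < d \<Longrightarrow> j' < d \<Longrightarrow> effect e C j j' = (if j = j' then 1 else 0)"
  shows "chan d e C"
  using assms by (simp add: chan_def effect_def)

lemma psd_on_effect:
  assumes "psd_on (cell d e) C"
  shows "psd_on {..<d} (effect e C)"
proof -
  obtain m where m: "\<And>u v. u \<in> cell d e \<Longrightarrow> v \<in> cell d e \<Longrightarrow> C u v = (\<Sum>l\<in>cell d e. m l u * cnj (m l v))"
    using psd_on_gram[OF _ assms] by auto
  show ?thesis
  proof (rule psd_on_of_gram)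
    show "effect e C j j' = (\<Sum>t\<in>{..<e} \<times> cell d e. m (snd t) (j, fst t) * cnj (m (snd t) (j', fst t)))"
      if "j \<in> {..<d}" "j' \<in> {..<d}" for j j'
      using that by (simp add: effect_def m sum.cartesian_product' split_def)
  qed
qed

lemma effect_cnj:
  assumes "psd_on (cell d e) C" "j < d" "j' < d"
  shows "cnj (effect e C j j') = effect e C j' j"
  using psd_on_hermitian[OF psd_on_effect[OF assms(1)], of j j'] assms by simp

lemma effect_sum: "effect e (\<lambda>u v. \<Sum>x\<in>S. C x u v) j j' = (\<Sum>x\<in>S. effect e (C x) j j')"
  unfolding effect_def by (rule sum.swap)

lemma effect_sand:
  "effect e (sand d P Q C) j j' = (\<Sum>i<d. \<Sum>i'<d. P j i * effect e C i i' * Q i' j')"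
  unfolding effect_def sand_def
  by (simp add: sum_distrib_left sum_distrib_right, subst sum.swap, rule sum.cong[OF refl], rule sum.swap)

lemma effect_sand_chan:
  assumes "chan d e C"
  shows "effect e (sand d P Q C) j j' = (\<Sum>i<d. P j i * Q i j')"
proof -
  have "effect e (sand d P Q C) j j' = (\<Sum>i<d. \<Sum>i'<d. if i' = i then P j i * Q i j' else 0)"
    unfolding effect_sand using assms by (intro sum.cong refl) (auto simp: chan_effect)
  then show ?thesis by simp
qed

lemma psd_on_sand:
  assumes "psd_on (cell d e) C" and "\<And>i j. i < d \<Longrightarrow> j < d \<Longrightarrow> Q i j = cnj (P j i)"
  shows "psd_on (cell d e) (sand d P Q C)"
proof -
  obtain m where m: "\<And>u v. u \<in> cell d e \<Longrightarrow> v \<in> cell d e \<Longrightarrow> C u v = (\<Sum>l\<in>cell d e. m l u * cnj (m l v))"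
    using psd_on_gram[OF _ assms(1)] by auto
  define w where "w = (\<lambda>l (j, r). \<Sum>i<d. P j i * m l (i, r))"
  show ?thesis
  proof (rule psd_on_of_gram)
    fix u v assume uv: "u \<in> cell d e" "v \<in> cell d e"
    obtain j r j' r' where e: "u = (j, r)" "v = (j', r')" by (metis surj_pair)
    have "sand d P Q C u v = (\<Sum>i<d. \<Sum>i'<d. \<Sum>l\<in>cell d e. (P j i * m l (i, r)) * (cnj (P j' i') * cnj (m l (i', r'))))"
      unfolding sand_def e using uv
      by (simp add: e m assms(2) sum_distrib_left sum_distrib_right mult_ac)
    also have "\<dots> = (\<Sum>l\<in>cell d e. \<Sum>i<d. \<Sum>i'<d. (P j i * m l (i, r)) * (cnj (P j' i') * cnj (m l (i', r'))))"
      by (rule trans[OF sum.cong[OF refl sum.swap]], rule sum.swap)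
    also have "\<dots> = (\<Sum>l\<in>cell d e. w l u * cnj (w l v))"
      by (simp add: w_def e sum_product)
    finally show "sand d P Q C u v = (\<Sum>l\<in>cell d e. w l u * cnj (w l v))" .
  qed
qed

lemma psd_on_sand_measurement:
  assumes "projective_measurement d S P" "c \<in> S" "psd_on (cell d e) C"
  shows "psd_on (cell d e) (sand d (P c) (P c) C)"
  using assms by (intro psd_on_sand) (simp_all add: projective_measurement_cnj)

text \<open>A projective measurement followed by a channel that may depend on its result: the
  effects of the branches are the projectors, and these sum to the identity.\<close>

lemma chan_sand_sum:
  assumes P: "projective_measurement d S P" and C: "\<And>c. c \<in> S \<Longrightarrow> chan d e (C c)"
  shows "chan d e (\<lambda>u v. \<Sum>c\<in>S. sand d (P c) (P c) (C c) u v)"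
proof (rule chanI)
  show "psd_on (cell d e) (\<lambda>u v. \<Sum>c\<in>S. sand d (P c) (P c) (C c) u v)"
    using C by (intro psd_on_sum psd_on_sand_measurement[OF P]) (auto simp: chan_def)
  show "effect e (\<lambda>u v. \<Sum>c\<in>S. sand d (P c) (P c) (C c) u v) j j' = (if j = j' then 1 else 0)"
    if "j < d" "j' < d" for j j'
    using that
    by (simp add: effect_sum effect_sand_chan[OF C] projective_measurement_orth[OF P] projective_measurement_sum[OF P])
qed

lemma psd_on_add:
  assumes "psd_on S M" "psd_on S M'"
  shows "psd_on S (\<lambda>u v. M u v + M' u v)"
  unfolding psd_on_def
proof
  fix \<psi> :: "'a \<Rightarrow> complex"
  have "(\<Sum>u\<in>S. \<Sum>v\<in>S. cnj (\<psi> u) * (M u v + M' u v) * \<psi> v)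
    = (\<Sum>u\<in>S. \<Sum>v\<in>S. cnj (\<psi> u) * M u v * \<psi> v) + (\<Sum>u\<in>S. \<Sum>v\<in>S. cnj (\<psi> u) * M' u v * \<psi> v)"
    by (simp add: ring_distribs sum.distrib)
  then show "0 \<le> (\<Sum>u\<in>S. \<Sum>v\<in>S. cnj (\<psi> u) * (M u v + M' u v) * \<psi> v)"
    using psd_onD[OF assms(1), of \<psi>] psd_onD[OF assms(2), of \<psi>] by simp
qed

lemma subchan_summand:
  assumes "finite S" "x \<in> S" "\<And>y. y \<in> S \<Longrightarrow> psd_on (cell d e) (C y)"
    and "chan d e (\<lambda>u v. \<Sum>y\<in>S. C y u v)"
  shows "subchan d e (C x)"
  unfolding subchan_def
proof (intro conjI exI)
  show "psd_on (cell d e) (C x)" using assms by simp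
  show "psd_on (cell d e) (\<lambda>u v. \<Sum>y\<in>S-{x}. C y u v)"
    using assms by (intro psd_on_sum) auto
  show "chan d e (\<lambda>u v. C x u v + (\<Sum>y\<in>S-{x}. C y u v))"
    using assms by (simp add: sum.remove[of S x])
qed

text \<open>In Gram form the value is a sum of squared moduli, so all overlaps of
  \<open>\<psi>\<close> with the Gram vectors vanish.\<close>

lemma psd_on_form_zero:
  assumes "finite S" "psd_on S M" "(\<Sum>u\<in>S. \<Sum>v\<in>S. cnj (\<psi> u) * M u v * \<psi> v) = 0" "u \<in> S"
  shows "(\<Sum>v\<in>S. M u v * \<psi> v) = 0"
proof -
  obtain m where m: "\<And>u v. u \<in> S \<Longrightarrow> v \<in> S \<Longrightarrow> M u v = (\<Sum>l\<in>S. m l u * cnj (m l v))"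
    using psd_on_gram[OF assms(1,2)] by auto
  define y where "y = (\<lambda>l. \<Sum>v\<in>S. cnj (m l v) * \<psi> v)"
  have My: "(\<Sum>v\<in>S. M u v * \<psi> v) = (\<Sum>l\<in>S. m l u * y l)" if "u \<in> S" for u
    using that by (simp add: m y_def sum_distrib_left sum_distrib_right mult.assoc) (rule sum.swap)
  have cy: "cnj (y l) = (\<Sum>u\<in>S. cnj (\<psi> u) * m l u)" for l
    by (simp add: y_def mult.commute)
  have "0 = (\<Sum>u\<in>S. cnj (\<psi> u) * (\<Sum>v\<in>S. M u v * \<psi> v))"
    using assms(3) by (simp add: sum_distrib_left mult.assoc)
  also have "\<dots> = (\<Sum>u\<in>S. \<Sum>l\<in>S. cnj (\<psi> u) * m l u * y l)"
    by (intro sum.cong refl) (simp add: My sum_distrib_left mult.assoc)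
  also have "\<dots> = (\<Sum>l\<in>S. cnj (y l) * y l)"
    by (subst sum.swap) (simp add: cy sum_distrib_right)
  finally have "\<forall>l\<in>S. cnj (y l) * y l = 0"
    using assms(1) by (subst sum_nonneg_eq_0_iff[symmetric]) (auto intro: cnj_mult_self_nonneg)
  then show ?thesis using My[OF assms(4)] by simp
qed

section \<open>Positive functionals on the Choi matrices of one party\<close>

text \<open>Abstracts the dependence of \<open>tr_prod\<close> on one slot while all other slots are
  kept fixed; see \<open>positive_functional_slot\<close>.\<close>

definition positive_functional :: "nat \<Rightarrow> nat \<Rightarrow> ((nat \<times> nat) cmat \<Rightarrow> complex) \<Rightarrow> bool" where
  "positive_functional d e T \<longleftrightarrow>
     (\<forall>c G H. T (\<lambda>u v. c * G u v + H u v) = c * T G + T H) \<and>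
     (\<forall>G H. (\<forall>u\<in>cell d e. \<forall>v\<in>cell d e. G u v = H u v) \<longrightarrow> T G = T H) \<and>
     (\<forall>G. psd_on (cell d e) G \<longrightarrow> 0 \<le> T G)"

context
  fixes d e :: nat and T :: "(nat \<times> nat) cmat \<Rightarrow> complex"
  assumes T: "positive_functional d e T"
begin

lemma positive_functional_cong:
  "(\<And>u v. u \<in> cell d e \<Longrightarrow> v \<in> cell d e \<Longrightarrow> G u v = H u v) \<Longrightarrow> T G = T H"
  using T unfolding positive_functional_def by blast

lemma positive_functional_nonneg: "psd_on (cell d e) G \<Longrightarrow> 0 \<le> T G"
  using T unfolding positive_functional_def by blast

lemma positive_functional_linear: "T (\<lambda>u v. c * G u v + H u v) = c * T G + T H"
  using T unfolding positive_functional_def by blast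

lemma positive_functional_add: "T (\<lambda>u v. G u v + H u v) = T G + T H"
  using positive_functional_linear[of 1 G H] by simp

lemma positive_functional_sum:
  assumes "finite L"
  shows "T (\<lambda>u v. \<Sum>l\<in>L. c l * G l u v) = (\<Sum>l\<in>L. c l * T (G l))"
  using assms
proof induction
  case empty
  show ?case using positive_functional_add[of "\<lambda>_ _. 0" "\<lambda>_ _. 0"] by simp
next
  case (insert l L)
  then show ?case by (simp add: positive_functional_linear)
qed

text \<open>Two maps with the same effect can be completed to channels by the same third map.\<close>
lemma positive_functional_effect:
  assumes norm: "\<And>C. chan d e C \<Longrightarrow> T C = 1"
    and C: "subchan d e C" and C': "psd_on (cell d e) C'"
    and eff: "\<And>j j'. j < d \<Longrightarrow> j' < d \<Longrightarrow> effect e C j j' = effect e C' j j'"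
  shows "T C = T C'"
proof -
  obtain L where L: "psd_on (cell d e) L" "chan d e (\<lambda>u v. C u v + L u v)"
    using C by (auto simp: subchan_def)
  have eff_add: "effect e (\<lambda>u v. K u v + L u v) j j' = effect e K j j' + effect e L j j'" for K j j'
    by (simp add: effect_def sum.distrib)
  have c': "chan d e (\<lambda>u v. C' u v + L u v)"
    using psd_on_add[OF C' L(1)] chan_effect[OF L(2)] eff by (intro chanI) (simp_all add: eff_add)
  have "T C' + T L = T C + T L"
    using norm[OF L(2)] norm[OF c'] by (simp add: positive_functional_add)
  then show ?thesis by simp
qed

text \<open>A normalised functional is a state acting on effects: feed the effect into the fixed output
  \<open>0\<close>.\<close>
lemma positive_functional_state:
  assumes "0 < e" and norm: "\<And>C. chan d e C \<Longrightarrow> T C = 1"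
  shows "\<exists>R. psd_on {..<d} R \<and>
    (\<forall>C. subchan d e C \<longrightarrow> T C = (\<Sum>j<d. \<Sum>j'<d. effect e C j j' * R j j'))"
proof (intro exI conjI allI impI)
  define G :: "nat \<times> nat \<Rightarrow> (nat \<times> nat) cmat" where
    "G = (\<lambda>(i, i') u v. if u = (i, 0) \<and> v = (i', 0) then 1 else 0)"
  have expand: "T (\<lambda>u v. if snd u = 0 \<and> snd v = 0 then K (fst u) (fst v) else 0)
      = (\<Sum>j<d. \<Sum>j'<d. K j j' * T (G (j, j')))" for K
  proof -
    have "T (\<lambda>u v. if snd u = 0 \<and> snd v = 0 then K (fst u) (fst v) else 0)
        = T (\<lambda>u v. \<Sum>l\<in>{..<d} \<times> {..<d}. K (fst l) (snd l) * G l u v)"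
    proof (rule positive_functional_cong)
      fix u v assume uv: "u \<in> cell d e" "v \<in> cell d e"
      obtain j r j' r' where e: "u = (j, r)" "v = (j', r')" by (metis surj_pair)
      have "(\<Sum>l\<in>{..<d} \<times> {..<d}. K (fst l) (snd l) * G l u v)
          = (\<Sum>l\<in>{..<d} \<times> {..<d}. if l = (fst u, fst v) then (if snd u = 0 \<and> snd v = 0 then K (fst u) (fst v) else 0) else 0)"
        by (intro sum.cong refl) (auto simp: G_def e split: if_splits)
      also have "\<dots> = (if snd u = 0 \<and> snd v = 0 then K (fst u) (fst v) else 0)"
        using uv by (subst sum.delta) auto
      finally show "(if snd u = 0 \<and> snd v = 0 then K (fst u) (fst v) else 0)
          = (\<Sum>l\<in>{..<d} \<times> {..<d}. K (fst l) (snd l) * G l u v)" ..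
    qed
    also have "\<dots> = (\<Sum>l\<in>{..<d} \<times> {..<d}. K (fst l) (snd l) * T (G l))"
      by (rule positive_functional_sum) simp
    finally show ?thesis by (simp add: sum.cartesian_product split_def)
  qed
  show "psd_on {..<d} (\<lambda>j j'. T (G (j, j')))"
    unfolding psd_on_def
  proof
    fix \<psi> :: "nat \<Rightarrow> complex"
    have "psd_on (cell d e) (\<lambda>u v. if snd u = 0 \<and> snd v = 0 then cnj (\<psi> (fst u)) * \<psi> (fst v) else 0)"
      by (rule psd_on_of_gram[where L = "{()}" and m = "\<lambda>_ u. if snd u = 0 then cnj (\<psi> (fst u)) else 0"]) auto
    from positive_functional_nonneg[OF this]
    show "0 \<le> (\<Sum>j<d. \<Sum>j'<d. cnj (\<psi> j) * T (G (j, j')) * \<psi> j')"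
      unfolding expand[of "\<lambda>j j'. cnj (\<psi> j) * \<psi> j'"] by (simp add: mult_ac)
  qed
  fix C assume C: "subchan d e C"
  \<comment> \<open>\<open>C'\<close> discards the output of \<open>C\<close> and prepares basis
    state 0 instead, which keeps the effect. It is a combination of the matrix units
    \<open>G\<close>, so \<open>T\<close> of it is read off from the matrix of values
    \<open>T (G (j, j'))\<close>.\<close>
  define C' :: "(nat \<times> nat) cmat" where
    "C' = (\<lambda>u v. if snd u = 0 \<and> snd v = 0 then effect e C (fst u) (fst v) else 0)"
  have "psd_on {..<d} (effect e C)" using C by (auto simp: subchan_def intro: psd_on_effect)
  then obtain m where m: "\<And>i j. i < d \<Longrightarrow> j < d \<Longrightarrow> effect e C i j = (\<Sum>l<d. m l i * cnj (m l j))"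
    using psd_on_gram[of "{..<d}" "effect e C"] by auto
  have "psd_on (cell d e) C'"
    by (rule psd_on_of_gram[where L = "{..<d}" and m = "\<lambda>l u. if snd u = 0 then m l (fst u) else 0"])
      (auto simp: C'_def m)
  moreover have "effect e C' j j' = effect e C j j'" for j j'
    using \<open>0 < e\<close> unfolding effect_def[of e C'] by (simp add: C'_def)
  ultimately have "T C = T C'"
    by (intro positive_functional_effect[OF norm C]) auto
  then show "T C = (\<Sum>j<d. \<Sum>j'<d. effect e C j j' * T (G (j, j')))"
    unfolding C'_def expand .
qed

text \<open>Write the state as a sum of rank-one terms. If an effect has value 0, positivity puts
  each of their vectors in its kernel; the effect of \<open>Z\<close> annihilates whatever lies in
  all these kernels.\<close>

lemma positive_functional_zero:
  assumes "0 < e" and norm: "\<And>C. chan d e C \<Longrightarrow> T C = 1"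
    and F: "\<And>C. C \<in> F \<Longrightarrow> subchan d e C \<and> T C = 0"
    and Z: "subchan d e Z"
    and ker: "\<And>u j. (\<And>C i. C \<in> F \<Longrightarrow> i < d \<Longrightarrow> (\<Sum>j<d. effect e C i j * u j) = 0) \<Longrightarrow> j < d \<Longrightarrow>
      (\<Sum>j'<d. effect e Z j j' * u j') = 0"
  shows "T Z = 0"
proof -
  obtain R where R: "psd_on {..<d} R"
    and TR: "\<And>C. subchan d e C \<Longrightarrow> T C = (\<Sum>j<d. \<Sum>j'<d. effect e C j j' * R j j')"
    using positive_functional_state[OF assms(1) norm] by auto
  obtain r where r: "\<And>i j. i < d \<Longrightarrow> j < d \<Longrightarrow> R i j = (\<Sum>l<d. r l i * cnj (r l j))"
    using psd_on_gram[OF _ R] by auto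
  have form: "T C = (\<Sum>l<d. \<Sum>j<d. \<Sum>j'<d. r l j * effect e C j j' * cnj (r l j'))" if "subchan d e C" for C
  proof -
    have "T C = (\<Sum>j<d. \<Sum>j'<d. \<Sum>l<d. r l j * effect e C j j' * cnj (r l j'))"
      unfolding TR[OF that] by (intro sum.cong refl) (simp add: r sum_distrib_left mult_ac)
    also have "\<dots> = (\<Sum>l<d. \<Sum>j<d. \<Sum>j'<d. r l j * effect e C j j' * cnj (r l j'))"
      by (rule trans[OF sum.cong[OF refl sum.swap]], rule sum.swap)
    finally show ?thesis .
  qed
  have Fr: "(\<Sum>j<d. effect e C i j * cnj (r l j)) = 0" if C: "C \<in> F" and i: "i < d" and l: "l < d" for C i l
  proof -
    have psd: "psd_on {..<d} (effect e C)" using F[OF C] by (auto simp: subchan_def intro: psd_on_effect)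
    have nn: "0 \<le> (\<Sum>j<d. \<Sum>j'<d. r l j * effect e C j j' * cnj (r l j'))" for l
      using psd_onD[OF psd, of "\<lambda>j. cnj (r l j)"] by simp
    have "(\<Sum>l<d. \<Sum>j<d. \<Sum>j'<d. r l j * effect e C j j' * cnj (r l j')) = 0"
      using trans[OF form[symmetric]] F[OF C] by blast
    then have "(\<Sum>j<d. \<Sum>j'<d. r l j * effect e C j j' * cnj (r l j')) = 0"
      \<comment> \<open>Each rank-one component contributes a nonnegative amount, so a zero total
        forces zero for every \<open>l\<close> separately.\<close>
      using l nn by (subst (asm) sum_nonneg_eq_0_iff) auto
    then show ?thesis
      using psd_on_form_zero[OF _ psd, of "\<lambda>j. cnj (r l j)" i] i by simp
  qed
  have "(\<Sum>j<d. \<Sum>j'<d. r l j * effect e Z j j' * cnj (r l j')) = 0" if "l < d" for l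
  proof -
    have "(\<Sum>j'<d. effect e Z j j' * cnj (r l j')) = 0" if "j < d" for j
      using ker[of "\<lambda>j. cnj (r l j)" j] Fr \<open>l < d\<close> that by blast
    then show ?thesis by (simp add: mult.assoc flip: sum_distrib_left)
  qed
  then show ?thesis using form[OF Z] by simp
qed

text \<open>The matrix of values \<open>T (P c C P c')\<close> is positive, so a vanishing diagonal entry kills the
  coherences of that outcome.\<close>
lemma positive_functional_pinch:
  assumes P: "projective_measurement d S P" and C: "psd_on (cell d e) C" and c0: "c0 \<in> S"
    and zero: "\<And>c. c \<in> S \<Longrightarrow> c \<noteq> c0 \<Longrightarrow> T (sand d (P c) (P c) C) = 0"
  shows "T (sand d (P c0) (P c0) C) = T C"
proof -
  note fin = projective_measurement_finite[OF P]
  define K where "K = (\<lambda>c c'. T (sand d (P c) (P c') C))"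
  have comb: "T (sand d (\<lambda>i j. \<Sum>c\<in>S. p c * P c i j) (\<lambda>i j. \<Sum>c\<in>S. q c * P c i j) C)
      = (\<Sum>c\<in>S. \<Sum>c'\<in>S. p c * K c c' * q c')" for p q
  proof -
    have "sand d (\<lambda>i j. \<Sum>c\<in>S. p c * P c i j) (\<lambda>i j. \<Sum>c\<in>S. q c * P c i j) C
        = (\<lambda>u v. \<Sum>t\<in>S \<times> S. (p (fst t) * q (snd t)) * sand d (P (fst t)) (P (snd t)) C u v)"
    proof (intro ext)
      fix u v :: "nat \<times> nat"
      obtain j r j' r' where e: "u = (j, r)" "v = (j', r')" by (metis surj_pair)
      have "(\<Sum>t\<in>S \<times> S. (p (fst t) * q (snd t)) * sand d (P (fst t)) (P (snd t)) C u v)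
        = (\<Sum>t\<in>S \<times> S. \<Sum>i<d. \<Sum>i'<d. p (fst t) * P (fst t) j i * (q (snd t) * P (snd t) i' j') * C (i, r) (i', r'))"
        by (simp add: sand_def e sum_distrib_left mult_ac)
      also have "\<dots> = (\<Sum>i<d. \<Sum>i'<d. \<Sum>t\<in>S \<times> S. p (fst t) * P (fst t) j i * (q (snd t) * P (snd t) i' j') * C (i, r) (i', r'))"
        by (subst sum.swap, rule sum.cong[OF refl], rule sum.swap)
      also have "\<dots> = (\<Sum>i<d. \<Sum>i'<d. (\<Sum>c\<in>S. p c * P c j i) * (\<Sum>c\<in>S. q c * P c i' j') * C (i, r) (i', r'))"
        unfolding sum_product by (simp add: sum.cartesian_product split_def sum_distrib_right)
      finally show "sand d (\<lambda>i j. \<Sum>c\<in>S. p c * P c i j) (\<lambda>i j. \<Sum>c\<in>S. q c * P c i j) C u v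
        = (\<Sum>t\<in>S \<times> S. (p (fst t) * q (snd t)) * sand d (P (fst t)) (P (snd t)) C u v)"
        by (simp add: sand_def e mult_ac)
    qed
    moreover have "finite (S \<times> S)" using fin by simp
    ultimately have "T (sand d (\<lambda>i j. \<Sum>c\<in>S. p c * P c i j) (\<lambda>i j. \<Sum>c\<in>S. q c * P c i j) C)
        = (\<Sum>t\<in>S \<times> S. (p (fst t) * q (snd t)) * K (fst t) (snd t))"
      by (simp only: positive_functional_sum K_def)
    then show ?thesis by (simp add: sum.cartesian_product split_def mult_ac)
  qed
  \<comment> \<open>By \<open>comb\<close>, the form of \<open>K\<close> at \<open>\<psi>\<close> is
    the value of \<open>T\<close> on one compression of \<open>C\<close> by a combined operator,
    hence nonnegative.\<close>
  have psdK: "psd_on S K"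
    unfolding psd_on_def
  proof
    fix \<psi> :: "'a \<Rightarrow> complex"
    have "psd_on (cell d e) (sand d (\<lambda>i j. \<Sum>c\<in>S. cnj (\<psi> c) * P c i j) (\<lambda>i j. \<Sum>c\<in>S. \<psi> c * P c i j) C)"
      by (rule psd_on_sand[OF C]) (simp add: projective_measurement_cnj[OF P])
    from positive_functional_nonneg[OF this]
    show "0 \<le> (\<Sum>u\<in>S. \<Sum>v\<in>S. cnj (\<psi> u) * K u v * \<psi> v)" unfolding comb .
  qed
  have K0: "K c c' = 0" if "c \<in> S" "c' \<in> S" "\<not> (c = c0 \<and> c' = c0)" for c c'
  proof (cases "c = c0")
    case False
    then have "K c c = 0" using zero that by (simp add: K_def)
    then show ?thesis using psd_on_zero_diag[OF psdK fin] that by simp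
  next
    case True
    then have "K c' c' = 0" using zero that by (simp add: K_def)
    then have "K c' c = 0" using psd_on_zero_diag[OF psdK fin] that by simp
    then show ?thesis using psd_on_hermitian[OF psdK fin, of c' c] that by simp
  qed
  \<comment> \<open>The projectors sum to the identity, so \<open>T C\<close> is the sum of all
    entries of \<open>K\<close>, of which only the one at \<open>c0\<close> survives.\<close>
  have "T C = T (sand d (\<lambda>i j. \<Sum>c\<in>S. 1 * P c i j) (\<lambda>i j. \<Sum>c\<in>S. 1 * P c i j) C)"
  proof (rule positive_functional_cong)
    fix u v assume uv: "u \<in> cell d e" "v \<in> cell d e"
    obtain j r j' r' where e: "u = (j, r)" "v = (j', r')" by (metis surj_pair)
    have "sand d (\<lambda>i j. \<Sum>c\<in>S. 1 * P c i j) (\<lambda>i j. \<Sum>c\<in>S. 1 * P c i j) C u v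
        = (\<Sum>i<d. \<Sum>i'<d. if i' = j' then (if i = j then C (i, r) (i', r') else 0) else 0)"
      unfolding sand_def e prod.case
      by (intro sum.cong refl) (use uv e projective_measurement_sum[OF P] in auto)
    also have "\<dots> = C u v" using uv e by simp
    finally show "C u v = sand d (\<lambda>i j. \<Sum>c\<in>S. 1 * P c i j) (\<lambda>i j. \<Sum>c\<in>S. 1 * P c i j) C u v" ..
  qed
  also have "\<dots> = (\<Sum>c\<in>S. \<Sum>c'\<in>S. K c c')" unfolding comb by simp
  also have "\<dots> = (\<Sum>c\<in>S. \<Sum>c'\<in>S. if c' = c0 then (if c = c0 then K c0 c0 else 0) else 0)"
    using K0 by (intro sum.cong refl) auto
  also have "\<dots> = K c0 c0" using fin c0 by simp
  finally show ?thesis by (simp add: K_def)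
qed

end

lemma positive_functional_slot:
  assumes "psd_on (pm_basis N dI dO) W" "k < N"
    and "\<And>j. j < N \<Longrightarrow> j \<noteq> k \<Longrightarrow> psd_on (cell (dI j) (dO j)) (M j)"
  shows "positive_functional (dI k) (dO k) (\<lambda>Z. tr_prod N dI dO W (M(k := Z)))"
  unfolding positive_functional_def
proof (intro conjI allI impI)
  fix c and G H :: "(nat \<times> nat) cmat"
  show "tr_prod N dI dO W (M(k := \<lambda>u v. c * G u v + H u v))
      = c * tr_prod N dI dO W (M(k := G)) + tr_prod N dI dO W (M(k := H))"
    using tr_prod_slot[OF assms(2), where L = "UNIV :: bool set" and c = "\<lambda>b. if b then c else 1"
        and G = "\<lambda>b. if b then G else H", of dI dO W M]
    by (simp add: UNIV_bool add.commute)
next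
  fix G H :: "(nat \<times> nat) cmat"
  assume "\<forall>u\<in>cell (dI k) (dO k). \<forall>v\<in>cell (dI k) (dO k). G u v = H u v"
  then show "tr_prod N dI dO W (M(k := G)) = tr_prod N dI dO W (M(k := H))"
    by (intro tr_prod_cong) auto
next
  fix G assume "psd_on (cell (dI k) (dO k)) G"
  then show "0 \<le> tr_prod N dI dO W (M(k := G))"
    using assms(3) by (intro tr_prod_nonneg[OF assms(1)]) auto
qed

lemma tr_prod_zero:
  assumes "k < N" "\<And>u v. M k u v = 0"
  shows "tr_prod N dI dO W M = 0"
proof -
  have "(\<Prod>k<N. M k (v k) (u k)) = 0" for u v
    using assms by (intro prod_zero bexI[of _ k]) simp_all
  then show ?thesis by (simp only: tr_prod_def mult_zero_right sum.neutral_const)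
qed

lemma sand_sum:
  "sand d P Q (\<lambda>u v. \<Sum>x\<in>S. C x u v) = (\<lambda>u v. \<Sum>x\<in>S. sand d P Q (C x) u v)"
proof (intro ext)
  fix u v :: "nat \<times> nat"
  obtain j r j' r' where e: "u = (j, r)" "v = (j', r')" by (metis surj_pair)
  show "sand d P Q (\<lambda>u v. \<Sum>x\<in>S. C x u v) u v = (\<Sum>x\<in>S. sand d P Q (C x) u v)"
    unfolding sand_def e prod.case sum_distrib_left sum_distrib_right
    by (rule trans[OF sum.cong[OF refl sum.swap]], rule sum.swap)
qed

section \<open>Joint label measurement in a deterministic process\<close>

locale deterministic_process =
  fixes N :: nat and A :: "nat \<Rightarrow> 'a set" and X :: "nat \<Rightarrow> 'x set"
    and f :: "nat \<Rightarrow> (nat \<Rightarrow> 'a) \<Rightarrow> 'x" and g :: "nat \<Rightarrow> (nat \<Rightarrow> 'a) \<Rightarrow> 'b"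
    and f' :: "nat \<Rightarrow> 'a \<Rightarrow> 'b \<Rightarrow> 'x"
    and dI dO :: "nat \<Rightarrow> nat" and W C
  assumes finA: "\<And>k. k < N \<Longrightarrow> finite (A k)" and neA: "\<And>k. k < N \<Longrightarrow> A k \<noteq> {}"
    and finX: "\<And>k. k < N \<Longrightarrow> finite (X k)"
    and fX: "\<And>k a. k < N \<Longrightarrow> a \<in> PiE {..<N} A \<Longrightarrow> f k a \<in> X k"
    and corr: "choi_correlation N A X (\<lambda>a x. if \<forall>k<N. x k = f k a then 1 else 0) dI dO W C"
    and f': "\<And>k a. k < N \<Longrightarrow> a \<in> PiE {..<N} A \<Longrightarrow> f k a = f' k (a k) (g k (drop_k N k a))"
    and faithful: "\<And>k c c'. k < N \<Longrightarrow> c \<in> PiE ({..<N} - {k}) A \<Longrightarrow> c' \<in> PiE ({..<N} - {k}) A \<Longrightarrow>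
      g k c \<noteq> g k c' \<Longrightarrow> \<exists>y\<in>A k. f k (c(k := y)) \<noteq> f k (c'(k := y))"
begin

definition "B k = g k ` PiE ({..<N} - {k}) A"
definition "labels k = insert None (Some ` B k)"
definition "G a = (\<lambda>k\<in>{..<N}. g k (drop_k N k a))"
definition "Ctot k a = (\<lambda>u v. \<Sum>x\<in>X k. C k a x u v)"

lemma dO_pos: "k < N \<Longrightarrow> 0 < dO k"
  using corr by (simp add: choi_correlation_def)

lemma psd_W: "psd_on (pm_basis N dI dO) W"
  using corr by (simp add: choi_correlation_def)

lemma W_chan: "(\<And>k. k < N \<Longrightarrow> chan (dI k) (dO k) (D k)) \<Longrightarrow> tr_prod N dI dO W D = 1"
  using corr by (simp add: choi_correlation_def)

lemma psd_C: "k < N \<Longrightarrow> a \<in> A k \<Longrightarrow> x \<in> X k \<Longrightarrow> psd_on (cell (dI k) (dO k)) (C k a x)"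
  using corr by (simp add: choi_correlation_def)

lemma chan_Ctot: "k < N \<Longrightarrow> a \<in> A k \<Longrightarrow> chan (dI k) (dO k) (Ctot k a)"
  using corr by (simp add: choi_correlation_def Ctot_def)

lemma prob_C: "a \<in> PiE {..<N} A \<Longrightarrow> x \<in> PiE {..<N} X \<Longrightarrow>
  tr_prod N dI dO W (\<lambda>k. C k (a k) (x k)) = (if \<forall>k<N. x k = f k a then 1 else 0)"
proof -
  assume "a \<in> PiE {..<N} A" "x \<in> PiE {..<N} X"
  with corr have eq: "complex_of_real (if \<forall>k<N. x k = f k a then 1 else 0) = tr_prod N dI dO W (\<lambda>k. C k (a k) (x k))"
    unfolding choi_correlation_def by blast
  show ?thesis unfolding eq[symmetric] by simp
qed

lemma finite_B: "finite (B k)"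
  unfolding B_def using finA by (intro finite_imageI finite_PiE) auto

lemma finite_labels: "finite (labels k)"
  by (simp add: labels_def finite_B)

lemma G_in_B: "a \<in> PiE {..<N} A \<Longrightarrow> k < N \<Longrightarrow> G a k \<in> B k"
  by (auto simp: G_def B_def intro!: drop_k_PiE)

lemma f_eq_f': "a \<in> PiE {..<N} A \<Longrightarrow> k < N \<Longrightarrow> f k a = f' k (a k) (G a k)"
  using f' by (simp add: G_def)

lemma f'_upd:
  assumes "c \<in> PiE ({..<N} - {k}) A" "y \<in> A k" "k < N"
  shows "f' k y (g k c) = f k (c(k := y))"
  using f'[OF assms(3) upd_PiE[OF assms]] by (simp add: drop_k_upd[OF assms(1)])

lemma measurement_exists:
  assumes k: "k < N"
  shows "\<exists>P. projective_measurement (dI k) (labels k) P \<and>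
     (\<forall>b\<in>B k. \<forall>u. (\<forall>a\<in>A k. \<forall>x\<in>X k. x \<noteq> f' k a b \<longrightarrow>
          (\<forall>i<dI k. (\<Sum>j<dI k. effect (dO k) (C k a x) i j * u j) = 0)) \<longrightarrow>
        (\<forall>i<dI k. (\<Sum>j<dI k. P (Some b) i j * u j) = u i))"
  unfolding labels_def
proof (rule exists_label_measurement[OF finA[OF k] finX[OF k] finite_B])
  show "cnj (effect (dO k) (C k a x) i j) = effect (dO k) (C k a x) j i"
    if "a \<in> A k" "x \<in> X k" "i < dI k" "j < dI k" for a x i j
    using effect_cnj[OF psd_C[OF k that(1,2)] that(3,4)] .
  show "(\<Sum>x\<in>X k. effect (dO k) (C k a x) i j) = (if i = j then 1 else 0)"
    if "a \<in> A k" "i < dI k" "j < dI k" for a i j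
    using chan_effect[OF chan_Ctot[OF k that(1)] that(2,3)] by (simp add: Ctot_def effect_sum)
  show "f' k a b \<in> X k" if "a \<in> A k" "b \<in> B k" for a b
  proof -
    obtain c where c: "c \<in> PiE ({..<N} - {k}) A" "b = g k c" using \<open>b \<in> B k\<close> unfolding B_def by blast
    show ?thesis unfolding c(2) f'_upd[OF c(1) \<open>a \<in> A k\<close> k]
      by (rule fX[OF k upd_PiE[OF c(1) \<open>a \<in> A k\<close> k]])
  qed
  show "\<exists>a\<in>A k. f' k a b \<noteq> f' k a b'" if b: "b \<in> B k" "b' \<in> B k" "b \<noteq> b'" for b b'
  proof -
    obtain c c' where c: "c \<in> PiE ({..<N} - {k}) A" "b = g k c" "c' \<in> PiE ({..<N} - {k}) A" "b' = g k c'"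
      using b by (auto simp: B_def)
    then show ?thesis
      using faithful[OF k c(1,3)] b(3) f'_upd[OF c(1) _ k] f'_upd[OF c(3) _ k] by auto
  qed
qed

text \<open>One measurement per party is fixed once, so that all stages of the induction over
  \<open>J\<close> speak about the same labels and projectors.\<close>

definition "P k = (SOME P. projective_measurement (dI k) (labels k) P \<and>
     (\<forall>b\<in>B k. \<forall>u. (\<forall>a\<in>A k. \<forall>x\<in>X k. x \<noteq> f' k a b \<longrightarrow>
          (\<forall>i<dI k. (\<Sum>j<dI k. effect (dO k) (C k a x) i j * u j) = 0)) \<longrightarrow>
        (\<forall>i<dI k. (\<Sum>j<dI k. P (Some b) i j * u j) = u i)))"

lemma P_measurement: "k < N \<Longrightarrow> projective_measurement (dI k) (labels k) (P k)"
  unfolding P_def by (rule someI_ex[OF measurement_exists, THEN conjunct1])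

lemma P_fixes:
  assumes "k < N" "b \<in> B k" "i < dI k"
    and "\<And>a x i. a \<in> A k \<Longrightarrow> x \<in> X k \<Longrightarrow> x \<noteq> f' k a b \<Longrightarrow> i < dI k \<Longrightarrow>
      (\<Sum>j<dI k. effect (dO k) (C k a x) i j * u j) = 0"
  shows "(\<Sum>j<dI k. P k (Some b) i j * u j) = u i"
  by (rule someI_ex[OF measurement_exists[OF assms(1)], THEN conjunct2, folded P_def, rule_format,
        OF assms(2) _ assms(3)]) (rule assms(4))

definition "S k c Z = sand (dI k) (P k c) (P k c) Z"

lemma psd_S: "k < N \<Longrightarrow> c \<in> labels k \<Longrightarrow> psd_on (cell (dI k) (dO k)) Z \<Longrightarrow> psd_on (cell (dI k) (dO k)) (S k c Z)"
  unfolding S_def by (rule psd_on_sand_measurement[OF P_measurement])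

text \<open>The setting \<open>a c\<close> may depend on the measured label. The constant choice
  gives the instruments \<open>D\<close>; the choice given by \<open>h\<close> gives the final
  normalisation argument.\<close>

lemma chan_S_sum:
  assumes "k < N" "\<And>c. c \<in> labels k \<Longrightarrow> a c \<in> A k"
  shows "chan (dI k) (dO k) (\<lambda>u v. \<Sum>y\<in>X k \<times> labels k. S k (snd y) (C k (a (snd y)) (fst y)) u v)"
proof -
  have "chan (dI k) (dO k) (\<lambda>u v. \<Sum>c\<in>labels k. S k c (Ctot k (a c)) u v)"
    unfolding S_def by (rule chan_sand_sum[OF P_measurement[OF assms(1)]]) (simp add: chan_Ctot assms)
  also have "(\<lambda>u v. \<Sum>c\<in>labels k. S k c (Ctot k (a c)) u v)
      = (\<lambda>u v. \<Sum>y\<in>X k \<times> labels k. S k (snd y) (C k (a (snd y)) (fst y)) u v)"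
    unfolding S_def Ctot_def sand_sum by (intro ext, subst sum.swap) (simp add: sum.cartesian_product split_def)
  finally show ?thesis .
qed

text \<open>Instrument with outcomes \<open>X k \<times> labels k\<close>: parties in \<open>J\<close> first measure their label, the
  others report the dummy label \<open>None\<close>.\<close>
definition "D J k a y = (if k \<in> J then S k (snd y) (C k a (fst y))
  else if snd y = None then C k a (fst y) else (\<lambda>_ _. 0))"

lemma psd_D:
  assumes "k < N" "a \<in> A k" "y \<in> X k \<times> labels k"
  shows "psd_on (cell (dI k) (dO k)) (D J k a y)"
proof -
  have "psd_on (cell (dI k) (dO k)) (\<lambda>_ _. 0)" by (simp add: psd_on_def)
  moreover have "fst y \<in> X k" "snd y \<in> labels k" using assms(3) by auto
  ultimately show ?thesis using assms(1,2) by (simp add: D_def psd_S psd_C)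
qed

lemma chan_D:
  assumes "k < N" "a \<in> A k"
  shows "chan (dI k) (dO k) (\<lambda>u v. \<Sum>y\<in>X k \<times> labels k. D J k a y u v)"
proof (cases "k \<in> J")
  case True
  then show ?thesis using chan_S_sum[OF assms(1), of "\<lambda>_. a"] assms(2) by (simp add: D_def)
next
  case False
  have "(\<Sum>y\<in>X k \<times> labels k. D J k a y u v) = Ctot k a u v" for u v
  proof -
    have "(\<Sum>y\<in>X k \<times> labels k. D J k a y u v)
        = (\<Sum>x\<in>X k. \<Sum>c\<in>labels k. if c = None then C k a x u v else 0)"
      unfolding sum.cartesian_product by (intro sum.cong refl) (use False in \<open>auto simp: D_def\<close>)
    also have "\<dots> = Ctot k a u v"
      using finite_labels by (simp add: Ctot_def) (simp add: labels_def)
    finally show ?thesis .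
  qed
  then show ?thesis using chan_Ctot[OF assms] by simp
qed

text \<open>Induction invariant: parties in \<open>J\<close> learn their true label with certainty,
  and the outcomes of \<open>f\<close> keep probability 1.\<close>

definition pinched_deterministic :: "nat set \<Rightarrow> bool" where
  "pinched_deterministic J \<longleftrightarrow> (\<forall>a\<in>PiE {..<N} A. \<forall>y\<in>PiE {..<N} (\<lambda>k. X k \<times> labels k).
     tr_prod N dI dO W (\<lambda>k. D J k (a k) (y k)) =
       (if \<forall>k<N. y k = (f k a, if k \<in> J then Some (G a k) else None) then 1 else 0))"

lemma pinched_deterministic_empty: "pinched_deterministic {}"
  unfolding pinched_deterministic_def
proof (intro ballI)
  fix a y assume a: "a \<in> PiE {..<N} A" and y: "y \<in> PiE {..<N} (\<lambda>k. X k \<times> labels k)"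
  have cond: "(\<forall>k<N. y k = (f k a, if k \<in> {} then Some (G a k) else None))
      \<longleftrightarrow> (\<forall>k<N. snd (y k) = None) \<and> (\<forall>k<N. fst (y k) = f k a)"
  proof -
    have "y k = (p, q) \<longleftrightarrow> snd (y k) = q \<and> fst (y k) = p" for k p q by (cases "y k") auto
    then show ?thesis by auto
  qed
  show "tr_prod N dI dO W (\<lambda>k. D {} k (a k) (y k)) =
      (if \<forall>k<N. y k = (f k a, if k \<in> {} then Some (G a k) else None) then 1 else 0)"
  proof (cases "\<forall>k<N. snd (y k) = None")
    case True
    let ?x = "\<lambda>k\<in>{..<N}. fst (y k)"
    have "?x \<in> PiE {..<N} X" using y by (auto simp: PiE_def Pi_def)
    moreover have "(\<forall>k<N. ?x k = f k a) \<longleftrightarrow> (\<forall>k<N. fst (y k) = f k a)" by auto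
    ultimately have "tr_prod N dI dO W (\<lambda>k. C k (a k) (?x k)) = (if \<forall>k<N. fst (y k) = f k a then 1 else 0)"
      using prob_C[OF a, of ?x] by presburger
    moreover have "tr_prod N dI dO W (\<lambda>k. D {} k (a k) (y k)) = tr_prod N dI dO W (\<lambda>k. C k (a k) (?x k))"
      using True by (intro tr_prod_cong) (simp add: D_def)
    ultimately show ?thesis unfolding cond using True by simp
  next
    case False
    then obtain k where "k < N" "snd (y k) \<noteq> None" by blast
    then have "tr_prod N dI dO W (\<lambda>k. D {} k (a k) (y k)) = 0"
      by (intro tr_prod_zero[of k]) (auto simp: D_def)
    then show ?thesis unfolding cond using False by simp
  qed
qed

text \<open>The label of \<open>k\<close> does not depend on its own setting, so varying that
  setting makes every outcome excluded by \<open>G a k\<close> have probability 0. The state at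
  \<open>k\<close> then lies in the range of the projector of \<open>Some (G a k)\<close>,
  orthogonal to that of \<open>c\<close>. This gives 0 summed over all outcomes, and positivity
  passes it on to each one.\<close>

lemma wrong_label_zero:
  assumes IH: "pinched_deterministic J" and k: "k < N" "k \<notin> J"
    and a: "a \<in> PiE {..<N} A" and y: "y \<in> PiE {..<N} (\<lambda>k. X k \<times> labels k)"
    and c: "c \<in> labels k" "c \<noteq> Some (G a k)" and x: "x \<in> X k"
  shows "tr_prod N dI dO W ((\<lambda>j. D J j (a j) (y j))(k := S k c (C k (a k) x))) = 0"
proof -
  have aA: "a j \<in> A j" if "j < N" for j using a that by auto
  \<comment> \<open>The outcomes of all other parties are summed out first, since a normalised
    functional on slot \<open>k\<close> requires channels in the other slots.\<close>
  define M where "M = (\<lambda>j u v. \<Sum>y\<in>X j \<times> labels j. D J j (a j) y u v)"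
  define T where "T = (\<lambda>Z. tr_prod N dI dO W (M(k := Z)))"
  have M: "chan (dI j) (dO j) (M j)" if "j < N" for j
    unfolding M_def by (rule chan_D[OF that aA[OF that]])
  have posT: "positive_functional (dI k) (dO k) T"
    unfolding T_def using M by (intro positive_functional_slot psd_W k) (auto simp: chan_def)
  have normT: "T Z = 1" if "chan (dI k) (dO k) Z" for Z
    unfolding T_def by (rule W_chan) (use that M in auto)
  define F where "F = {C k a' x' |a' x'. a' \<in> A k \<and> x' \<in> X k \<and> x' \<noteq> f' k a' (G a k)}"
  have F: "subchan (dI k) (dO k) Z \<and> T Z = 0" if "Z \<in> F" for Z
  proof -
    obtain a' x' where Z: "Z = C k a' x'" and a': "a' \<in> A k" and x': "x' \<in> X k" "x' \<noteq> f' k a' (G a k)"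
      using \<open>Z \<in> F\<close> unfolding F_def by blast
    have sub: "subchan (dI k) (dO k) (C k a' x')"
      by (rule subchan_summand[where C = "C k a'" and S = "X k"])
        (use finX x' psd_C chan_Ctot a' k in \<open>simp_all flip: Ctot_def\<close>)
    define b where "b = a(k := a')"
    have b: "b \<in> PiE {..<N} A" using a a' k by (auto simp: b_def PiE_def Pi_def extensional_def)
    have Gb: "G b k = G a k" using k by (simp add: G_def b_def drop_k_def)
    \<comment> \<open>Slot \<open>k\<close> keeps the single outcome \<open>x'\<close> with the
      dummy label: as \<open>k\<close> is not in \<open>J\<close>, its element there is the
      unmeasured \<open>C k a' x'\<close>.\<close>
    define Y where "Y = (\<lambda>j. if j = k then {(x', None)} else X j \<times> labels j)"
    have "T Z = tr_prod N dI dO W (\<lambda>j u v. \<Sum>y\<in>Y j. D J j (b j) y u v)"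
      unfolding T_def Z by (intro tr_prod_cong) (auto simp: M_def Y_def b_def D_def k)
    also have "\<dots> = (\<Sum>y\<in>PiE {..<N} Y. tr_prod N dI dO W (\<lambda>j. D J j (b j) (y j)))"
      by (rule tr_prod_expand) (auto simp: Y_def finX finite_labels)
    also have "\<dots> = 0"
    proof (intro sum.neutral ballI)
      fix y assume y: "y \<in> PiE {..<N} Y"
      have "y \<in> PiE {..<N} (\<lambda>j. X j \<times> labels j)"
        by (rule subsetD[OF PiE_mono y]) (use x' in \<open>auto simp: Y_def labels_def\<close>)
      moreover have "y k = (x', None)" using PiE_mem[OF y, of k] k by (simp add: Y_def)
      moreover have "x' \<noteq> f k b" using x'(2) f_eq_f'[OF b k(1)] Gb by (simp add: b_def)
      ultimately show "tr_prod N dI dO W (\<lambda>j. D J j (b j) (y j)) = 0"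
        using IH b k unfolding pinched_deterministic_def by auto
    qed
    finally show ?thesis using sub Z by simp
  qed
  have psdtot: "psd_on (cell (dI k) (dO k)) (Ctot k (a k))"
    using chan_Ctot[OF k(1) aA[OF k(1)]] by (simp add: chan_def)
  have sub: "subchan (dI k) (dO k) (S k c (Ctot k (a k)))"
    by (rule subchan_summand[where C = "\<lambda>c. S k c (Ctot k (a k))" and S = "labels k"])
      (use finite_labels c psd_S[OF k(1)] psdtot chan_sand_sum[OF P_measurement[OF k(1)]] chan_Ctot[OF k(1) aA[OF k(1)]]
        in \<open>simp_all add: S_def\<close>)
  have T0: "T (S k c (Ctot k (a k))) = 0"
  proof (rule positive_functional_zero[OF posT dO_pos[OF k(1)] _ _ sub])
    show "T Z = 1" if "chan (dI k) (dO k) Z" for Z by (rule normT[OF that])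
    show "subchan (dI k) (dO k) Z \<and> T Z = 0" if "Z \<in> F" for Z by (rule F[OF that])
    fix u j assume u: "\<And>Z i. Z \<in> F \<Longrightarrow> i < dI k \<Longrightarrow> (\<Sum>j<dI k. effect (dO k) Z i j * u j) = 0" and j: "j < dI k"
    let ?b = "Some (G a k)"
    have bl: "?b \<in> labels k" using G_in_B[OF a k(1)] by (simp add: labels_def)
    have Pu: "(\<Sum>j<dI k. P k ?b i j * u j) = u i" if "i < dI k" for i
      by (rule P_fixes[OF k(1) G_in_B[OF a k(1)] that]) (use u in \<open>auto simp: F_def\<close>)
    have "(\<Sum>j'<dI k. effect (dO k) (S k c (Ctot k (a k))) j j' * u j') = (\<Sum>j'<dI k. P k c j j' * u j')"
      using j c(1) unfolding S_def
      by (intro sum.cong refl)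
        (simp add: effect_sand_chan[OF chan_Ctot[OF k(1) aA[OF k(1)]]] projective_measurement_orth[OF P_measurement[OF k(1)]])
    also have "\<dots> = (\<Sum>j'<dI k. P k c j j' * (\<Sum>l<dI k. P k ?b j' l * u l))"
      by (intro sum.cong refl) (simp add: Pu)
    also have "\<dots> = (\<Sum>l<dI k. (\<Sum>j'<dI k. P k c j j' * P k ?b j' l) * u l)"
      unfolding sum_distrib_left sum_distrib_right by (subst sum.swap) (simp add: mult.assoc)
    also have "\<dots> = 0"
      using j c bl by (simp add: projective_measurement_orth[OF P_measurement[OF k(1)]])
    finally show "(\<Sum>j'<dI k. effect (dO k) (S k c (Ctot k (a k))) j j' * u j') = 0" .
  qed
  \<comment> \<open>Undoes the summation: the vanishing total is expanded into nonnegative terms,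
    one per joint outcome whose label at \<open>k\<close> is \<open>c\<close>; the required one is
    \<open>y\<close> with \<open>(x, c)\<close> at \<open>k\<close>.\<close>
  define Y where "Y = (\<lambda>j. if j = k then X k \<times> {c} else X j \<times> labels j)"
  define K where "K = (\<lambda>j y. if j = k then S k c (C k (a k) (fst y)) else D J j (a j) y)"
  have "T (S k c (Ctot k (a k))) = tr_prod N dI dO W (\<lambda>j u v. \<Sum>y\<in>Y j. K j y u v)"
    unfolding T_def
  proof (rule tr_prod_cong)
    fix j u v
    have "(\<Sum>y\<in>X k \<times> {c}. S k c (C k (a k) (fst y)) u v) = S k c (Ctot k (a k)) u v"
      by (simp add: S_def Ctot_def sand_sum sum.cartesian_product')
    then show "(M(k := S k c (Ctot k (a k)))) j u v = (\<Sum>y\<in>Y j. K j y u v)"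
      by (simp add: Y_def K_def M_def)
  qed
  also have "\<dots> = (\<Sum>y\<in>PiE {..<N} Y. tr_prod N dI dO W (\<lambda>j. K j (y j)))"
    by (rule tr_prod_expand) (auto simp: Y_def finX finite_labels)
  finally have sum0: "(\<Sum>y\<in>PiE {..<N} Y. tr_prod N dI dO W (\<lambda>j. K j (y j))) = 0"
    using T0 by simp
  have nn: "0 \<le> tr_prod N dI dO W (\<lambda>j. K j (y j))" if "y \<in> PiE {..<N} Y" for y
  proof (rule tr_prod_nonneg[OF psd_W])
    fix j assume j: "j < N"
    then have "y j \<in> Y j" using that by (auto simp: PiE_def Pi_def)
    then show "psd_on (cell (dI j) (dO j)) (K j (y j))"
      using j c aA by (auto simp: K_def Y_def psd_S psd_C psd_D split: if_splits)
  qed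
  have "finite (PiE {..<N} Y)" by (intro finite_PiE) (auto simp: Y_def finX finite_labels)
  moreover have yY: "y(k := (x, c)) \<in> PiE {..<N} Y"
    using y x k by (auto simp: PiE_def Pi_def Y_def extensional_def)
  ultimately have "\<forall>y\<in>PiE {..<N} Y. tr_prod N dI dO W (\<lambda>j. K j (y j)) = 0"
    using sum0 nn by (simp add: sum_nonneg_eq_0_iff)
  from bspec[OF this yY] have "tr_prod N dI dO W (\<lambda>j. K j ((y(k := (x, c))) j)) = 0" .
  moreover have "(\<lambda>j. K j ((y(k := (x, c))) j)) = (\<lambda>j. D J j (a j) (y j))(k := S k c (C k (a k) x))"
    by (auto simp: K_def fun_eq_iff)
  ultimately show ?thesis by simp
qed

text \<open>A wrong label at \<open>k\<close> gives 0. For the right label all competing diagonal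
  blocks are 0, so pinching keeps the unmeasured value, which is the invariant for \<open>J\<close>
  at the dummy label.\<close>

lemma pinched_deterministic_insert:
  assumes IH: "pinched_deterministic J" and k: "k < N" "k \<notin> J"
  shows "pinched_deterministic (insert k J)"
  unfolding pinched_deterministic_def
proof (intro ballI)
  fix a y assume a: "a \<in> PiE {..<N} A" and y: "y \<in> PiE {..<N} (\<lambda>k. X k \<times> labels k)"
  have aA: "a j \<in> A j" if "j < N" for j using a that by auto
  have yY: "y j \<in> X j \<times> labels j" if "j < N" for j using y that by auto
  obtain x c where xc: "y k = (x, c)" by (metis surj_pair)
  have x: "x \<in> X k" and c: "c \<in> labels k" using yY[OF k(1)] xc by auto
  define T where "T = (\<lambda>Z. tr_prod N dI dO W ((\<lambda>j. D J j (a j) (y j))(k := Z)))"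
  have posT: "positive_functional (dI k) (dO k) T"
    unfolding T_def by (rule positive_functional_slot[OF psd_W k(1)]) (rule psd_D[OF _ aA yY])
  have "(\<lambda>j. D (insert k J) j (a j) (y j)) = (\<lambda>j. D J j (a j) (y j))(k := S k c (C k (a k) x))"
    by (auto simp: fun_eq_iff D_def xc)
  then have lhs: "tr_prod N dI dO W (\<lambda>j. D (insert k J) j (a j) (y j)) = T (S k c (C k (a k) x))"
    by (simp add: T_def)
  show "tr_prod N dI dO W (\<lambda>j. D (insert k J) j (a j) (y j)) =
      (if \<forall>j<N. y j = (f j a, if j \<in> insert k J then Some (G a j) else None) then 1 else 0)"
  proof (cases "c = Some (G a k)")
    case False
    then have "T (S k c (C k (a k) x)) = 0"
      unfolding T_def by (intro wrong_label_zero[OF IH k a y c _ x])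
    then show ?thesis using lhs xc k False by auto
  next
    case True
    have "T (S k c (C k (a k) x)) = T (C k (a k) x)"
      unfolding S_def
    proof (rule positive_functional_pinch[OF posT P_measurement[OF k(1)] psd_C[OF k(1) aA[OF k(1)] x] c])
      fix c' assume "c' \<in> labels k" "c' \<noteq> c"
      then have "T (S k c' (C k (a k) x)) = 0"
        unfolding T_def using True by (intro wrong_label_zero[OF IH k a y _ _ x]) auto
      then show "T (sand (dI k) (P k c') (P k c') (C k (a k) x)) = 0" by (simp add: S_def)
    qed
    also have "(\<lambda>j. D J j (a j) (y j))(k := C k (a k) x) = (\<lambda>j. D J j (a j) ((y(k := (x, None))) j))"
      using k by (auto simp: fun_eq_iff D_def)
    then have "T (C k (a k) x) = tr_prod N dI dO W (\<lambda>j. D J j (a j) ((y(k := (x, None))) j))"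
      by (simp add: T_def)
    also have "\<dots> = (if \<forall>j<N. (y(k := (x, None))) j = (f j a, if j \<in> J then Some (G a j) else None) then 1 else 0)"
    proof -
      have "y(k := (x, None)) \<in> PiE {..<N} (\<lambda>k. X k \<times> labels k)"
        using y x k by (auto simp: PiE_def Pi_def extensional_def labels_def)
      then show ?thesis using IH a unfolding pinched_deterministic_def by blast
    qed
    also have "(\<forall>j<N. (y(k := (x, None))) j = (f j a, if j \<in> J then Some (G a j) else None))
        \<longleftrightarrow> (\<forall>j<N. y j = (f j a, if j \<in> insert k J then Some (G a j) else None))"
      using k xc True by (auto split: if_splits)
    finally show ?thesis using lhs by simp
  qed
qed

lemma pinched_deterministic_all: "pinched_deterministic {..<N}"
proof -
  have "finite J \<Longrightarrow> J \<subseteq> {..<N} \<Longrightarrow> pinched_deterministic J" for J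
    by (induction J rule: finite_induct) (auto intro: pinched_deterministic_empty pinched_deterministic_insert)
  then show ?thesis by simp
qed

theorem process_function_G: "process_function N A B G"
  unfolding process_function_def
proof (intro conjI ballI allI impI)
  show "G a \<in> PiE {..<N} B" if "a \<in> PiE {..<N} A" for a
    using G_in_B[OF that] by (auto simp: G_def)
next
  fix h :: "nat \<Rightarrow> 'b \<Rightarrow> 'a"
  assume h: "\<forall>k<N. \<forall>i\<in>B k. h k i \<in> A k"
  \<comment> \<open>The branch \<open>None\<close> must also perform some instrument for the whole
    to be a channel; an arbitrary setting serves.\<close>
  define hh where "hh = (\<lambda>k c. case c of Some b \<Rightarrow> h k b | None \<Rightarrow> (SOME a. a \<in> A k))"
  have hh_Some: "hh k (Some b) = h k b" for k b by (simp add: hh_def)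
  have hh: "hh k c \<in> A k" if "k < N" "c \<in> labels k" for k c
    using that h neA[OF that(1)] by (auto simp: hh_def labels_def some_in_eq)
  define Y where "Y = (\<lambda>k. X k \<times> labels k)"
  define al where "al = (\<lambda>y::nat \<Rightarrow> 'x \<times> 'b option. \<lambda>k\<in>{..<N}. hh k (snd (y k)))"
  \<comment> \<open>\<open>al y\<close> are the settings that the labels in \<open>y\<close> trigger
    through \<open>h\<close>; \<open>fixed y\<close> says that these settings in turn produce
    exactly the outcomes and labels of \<open>y\<close>.\<close>
  define fixed where "fixed = (\<lambda>y. \<forall>k<N. y k = (f k (al y), Some (G (al y) k)))"
  have al: "al y \<in> PiE {..<N} A" if "y \<in> PiE {..<N} Y" for y
  proof -
    have "snd (y k) \<in> labels k" if "k < N" for k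
      using \<open>y \<in> PiE {..<N} Y\<close> that by (auto simp: PiE_def Pi_def Y_def)
    then show ?thesis by (auto simp: al_def hh)
  qed
  have "1 = tr_prod N dI dO W (\<lambda>k u v. \<Sum>y\<in>Y k. S k (snd y) (C k (hh k (snd y)) (fst y)) u v)"
    unfolding Y_def by (rule W_chan[symmetric]) (simp add: chan_S_sum hh)
  also have "\<dots> = (\<Sum>y\<in>PiE {..<N} Y. tr_prod N dI dO W (\<lambda>k. S k (snd (y k)) (C k (hh k (snd (y k))) (fst (y k)))))"
    by (rule tr_prod_expand) (simp add: Y_def finX finite_labels)
  also have "\<dots> = (\<Sum>y\<in>PiE {..<N} Y. if fixed y then 1 else 0)"
  proof (rule sum.cong[OF refl])
    fix y assume y: "y \<in> PiE {..<N} Y"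
    \<comment> \<open>For one outcome tuple the label-dependent choice selects a single setting per
      party, so the element coincides with that of the instruments with fixed settings
      \<open>al y\<close>.\<close>
    have "tr_prod N dI dO W (\<lambda>k. S k (snd (y k)) (C k (hh k (snd (y k))) (fst (y k))))
        = tr_prod N dI dO W (\<lambda>k. D {..<N} k (al y k) (y k))"
      by (intro tr_prod_cong) (simp add: D_def al_def)
    also have "\<dots> = (if fixed y then 1 else 0)"
      using pinched_deterministic_all al[OF y] y
      unfolding pinched_deterministic_def fixed_def Y_def by simp
    finally show "tr_prod N dI dO W (\<lambda>k. S k (snd (y k)) (C k (hh k (snd (y k))) (fst (y k)))) = (if fixed y then 1 else 0)" .
  qed
  also have "\<dots> = of_nat (card {y \<in> PiE {..<N} Y. fixed y})"
  proof -
    have "finite (PiE {..<N} Y)" by (intro finite_PiE) (auto simp: Y_def finX finite_labels)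
    then show ?thesis by (simp flip: sum.inter_filter)
  qed
  finally have "card {y \<in> PiE {..<N} Y. fixed y} = 1" by (metis of_nat_1 of_nat_eq_iff)
  then obtain y0 where y0: "{y \<in> PiE {..<N} Y. fixed y} = {y0}" by (auto simp: card_1_singleton_iff)
  \<comment> \<open>A fixed point \<open>i\<close> determines a full outcome tuple, as
    \<open>f\<close> supplies the outcomes. Fixed points go to \<open>y0\<close>, and the labels
    recover \<open>i\<close>, hence uniqueness; existence reads the labels of \<open>y0\<close>
    back.\<close>
  define enc where "enc = (\<lambda>i::nat \<Rightarrow> 'b. \<lambda>k\<in>{..<N}. (f k (\<lambda>k\<in>{..<N}. h k (i k)), Some (i k)))"
  have al_enc: "al (enc i) = (\<lambda>k\<in>{..<N}. h k (i k))" for i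
    by (auto simp: al_def enc_def hh_def fun_eq_iff)
  have enc: "enc i = y0" if i: "i \<in> PiE {..<N} B" "G (\<lambda>k\<in>{..<N}. h k (i k)) = i" for i
  proof -
    have "(\<lambda>k\<in>{..<N}. h k (i k)) \<in> PiE {..<N} A" using i h by (auto simp: PiE_def Pi_def)
    then have "enc i \<in> PiE {..<N} Y"
      using i(1) fX by (auto simp: enc_def Y_def labels_def PiE_def Pi_def)
    moreover have "fixed (enc i)" unfolding fixed_def al_enc i(2) by (simp add: enc_def)
    ultimately show ?thesis using y0 by blast
  qed
  show "\<exists>!i. i \<in> PiE {..<N} B \<and> G (\<lambda>k\<in>{..<N}. h k (i k)) = i"
  proof (rule ex_ex1I)
    have y: "y0 \<in> PiE {..<N} Y" "fixed y0" using y0 by auto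
    let ?i = "G (al y0)"
    have "?i \<in> PiE {..<N} B" using G_in_B[OF al[OF y(1)]] by (auto simp: G_def)
    moreover have "(\<lambda>k\<in>{..<N}. h k (?i k)) = al y0"
    proof
      fix k
      show "(\<lambda>k\<in>{..<N}. h k (?i k)) k = al y0 k"
      proof (cases "k < N")
        case True
        then have "snd (y0 k) = Some (?i k)" using y(2) by (simp add: fixed_def)
        moreover have "al y0 k = hh k (snd (y0 k))" using True by (simp add: al_def)
        ultimately show ?thesis using True by (simp add: hh_Some)
      qed (simp add: al_def)
    qed
    ultimately show "\<exists>i. i \<in> PiE {..<N} B \<and> G (\<lambda>k\<in>{..<N}. h k (i k)) = i" by auto
  next
    fix i i' assume i: "i \<in> PiE {..<N} B \<and> G (\<lambda>k\<in>{..<N}. h k (i k)) = i"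
      and i': "i' \<in> PiE {..<N} B \<and> G (\<lambda>k\<in>{..<N}. h k (i' k)) = i'"
    then have ee: "enc i = enc i'" using enc by simp
    have "i k = i' k" if "k < N" for k
    proof -
      have "snd (enc i k) = snd (enc i' k)" by (simp add: ee)
      then show ?thesis using that by (simp add: enc_def)
    qed
    then show "i = i'" using i i' by (auto intro: PiE_ext)
  qed
qed

end

section \<open>Construction of the labels and the equivalence\<close>

text \<open>The label is the response function of party \<open>k\<close>, from its own setting to
  its outcome, for given settings of the others; \<open>f'\<close> decodes the label and evaluates
  it.\<close>

lemma exists_faithful_labels:
  fixes f :: "nat \<Rightarrow> (nat \<Rightarrow> 'a) \<Rightarrow> 'x"
  assumes finA: "\<forall>k<N. finite (A k)"
  shows "\<exists>(g :: nat \<Rightarrow> (nat \<Rightarrow> 'a) \<Rightarrow> nat) f'.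
    (\<forall>k<N. \<forall>a\<in>PiE {..<N} A. f k a = f' k (a k) (g k (drop_k N k a))) \<and>
    (\<forall>k<N. \<forall>a\<in>PiE ({..<N} - {k}) A. \<forall>a'\<in>PiE ({..<N} - {k}) A.
       g k a \<noteq> g k a' \<longleftrightarrow> (\<exists>ak\<in>A k. f k (a(k := ak)) \<noteq> f k (a'(k := ak))))"
proof -
  \<comment> \<open>Restricted to \<open>A k\<close>, so that equality of response functions means
    agreement on admissible settings. There are finitely many, so \<open>e\<close> can number them
    by naturals.\<close>
  define F where "F = (\<lambda>k c. \<lambda>y\<in>A k. f k (c(k := y)))"
  define R where "R = (\<lambda>k. F k ` PiE ({..<N} - {k}) A)"
  have finR: "finite (R k)" for k
    unfolding R_def using finA by (intro finite_imageI finite_PiE) auto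
  have "\<forall>k. \<exists>e :: ('a \<Rightarrow> 'x) \<Rightarrow> nat. inj_on e (R k)"
    using finite_imp_inj_to_nat_seg[OF finR] by blast
  from choice[OF this] obtain e :: "nat \<Rightarrow> ('a \<Rightarrow> 'x) \<Rightarrow> nat" where e: "\<And>k. inj_on (e k) (R k)" by blast
  define g where "g = (\<lambda>k c. e k (F k c))"
  define f' where "f' = (\<lambda>k y b. inv_into (R k) (e k) b y)"
  have FR: "F k c \<in> R k" if "c \<in> PiE ({..<N} - {k}) A" for k c
    using that by (simp add: R_def)
  have label: "f k a = f' k (a k) (g k (drop_k N k a))" if "k < N" "a \<in> PiE {..<N} A" for k a
  proof -
    have "a k \<in> A k" using that by auto
    then show ?thesis
      using inv_into_f_f[OF e FR[OF drop_k_PiE[OF that(2)]]] upd_drop_k[OF that(2,1)]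
      by (simp add: f'_def g_def F_def)
  qed
  have faithful: "g k a \<noteq> g k a' \<longleftrightarrow> (\<exists>ak\<in>A k. f k (a(k := ak)) \<noteq> f k (a'(k := ak)))"
    if "a \<in> PiE ({..<N} - {k}) A" "a' \<in> PiE ({..<N} - {k}) A" for k a a'
  proof -
    have "g k a = g k a' \<longleftrightarrow> F k a = F k a'"
      unfolding g_def by (rule inj_on_eq_iff[OF e FR[OF that(1)] FR[OF that(2)]])
    also have "\<dots> \<longleftrightarrow> (\<forall>y\<in>A k. f k (a(k := y)) = f k (a'(k := y)))"
      by (auto simp: F_def fun_eq_iff restrict_def)
    finally show ?thesis by blast
  qed
  show ?thesis
    by (intro exI[of _ g] exI[of _ f'] conjI allI impI ballI label faithful)
qed

theorem theorem4:
  fixes N :: nat and A :: "nat \<Rightarrow> 'a set" and X :: "nat \<Rightarrow> 'x set"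
    and f :: "nat \<Rightarrow> (nat \<Rightarrow> 'a) \<Rightarrow> 'x"
  assumes "\<forall>k<N. finite (A k) \<and> A k \<noteq> {}"
    and "\<forall>k<N. finite (X k) \<and> X k \<noteq> {}"
    and "\<forall>k<N. \<forall>a\<in>PiE {..<N} A. f k a \<in> X k"
  shows "quantum_process_correlation N A X (\<lambda>a x. if (\<forall>k<N. x k = f k a) then 1 else 0) \<longleftrightarrow>
    (\<exists>(g :: nat \<Rightarrow> (nat \<Rightarrow> 'a) \<Rightarrow> nat) (f' :: nat \<Rightarrow> 'a \<Rightarrow> nat \<Rightarrow> 'x).
       process_function N A (\<lambda>k. g k ` PiE ({..<N} - {k}) A)
         (\<lambda>a. \<lambda>k\<in>{..<N}. g k (drop_k N k a)) \<and>
       (\<forall>k<N. \<forall>a\<in>PiE {..<N} A. f k a = f' k (a k) (g k (drop_k N k a))) \<and>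
       (\<forall>k<N. \<forall>a\<in>PiE ({..<N} - {k}) A. \<forall>a'\<in>PiE ({..<N} - {k}) A.
          g k a \<noteq> g k a' \<longleftrightarrow> (\<exists>ak\<in>A k. f k (a(k := ak)) \<noteq> f k (a'(k := ak)))))"
    (is "?Q \<longleftrightarrow> ?R")
proof
  assume ?Q
  then obtain dI dO W C where
    corr: "choi_correlation N A X (\<lambda>a x. if (\<forall>k<N. x k = f k a) then 1 else 0) dI dO W C"
    unfolding quantum_process_correlation_iff_choi by blast
  have finA: "\<forall>k<N. finite (A k)" using assms(1) by blast
  from exists_faithful_labels[OF finA, where f = f] obtain g :: "nat \<Rightarrow> (nat \<Rightarrow> 'a) \<Rightarrow> nat" and f' where
    label: "\<forall>k<N. \<forall>a\<in>PiE {..<N} A. f k a = f' k (a k) (g k (drop_k N k a))" and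
    label_faithful: "\<forall>k<N. \<forall>a\<in>PiE ({..<N} - {k}) A. \<forall>a'\<in>PiE ({..<N} - {k}) A.
       g k a \<noteq> g k a' \<longleftrightarrow> (\<exists>ak\<in>A k. f k (a(k := ak)) \<noteq> f k (a'(k := ak)))"
    by (elim exE conjE) (rule that)
  interpret deterministic_process N A X f g f' dI dO W C
  proof
    show "finite (A k)" "A k \<noteq> {}" "finite (X k)" if "k < N" for k
      using assms(1,2) that by auto
    show "f k a \<in> X k" if "k < N" "a \<in> PiE {..<N} A" for k a using assms(3) that by blast
    show "f k a = f' k (a k) (g k (drop_k N k a))" if "k < N" "a \<in> PiE {..<N} A" for k a
      using label that by blast
    show "\<exists>y\<in>A k. f k (c(k := y)) \<noteq> f k (c'(k := y))"
      if "k < N" "c \<in> PiE ({..<N} - {k}) A" "c' \<in> PiE ({..<N} - {k}) A" "g k c \<noteq> g k c'" for k c c'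
      using label_faithful that by blast
  qed (rule corr)
  have "process_function N A (\<lambda>k. g k ` PiE ({..<N} - {k}) A) (\<lambda>a. \<lambda>k\<in>{..<N}. g k (drop_k N k a))"
    using process_function_G unfolding B_def[abs_def] G_def[abs_def] .
  then show ?R using label label_faithful by (intro exI[of _ g] exI[of _ f'] conjI)
next
  assume ?R
  then obtain g :: "nat \<Rightarrow> (nat \<Rightarrow> 'a) \<Rightarrow> nat" and f' where
    pf: "process_function N A (\<lambda>k. g k ` PiE ({..<N} - {k}) A) (\<lambda>a. \<lambda>k\<in>{..<N}. g k (drop_k N k a))" and
    f': "\<forall>k<N. \<forall>a\<in>PiE {..<N} A. f k a = f' k (a k) (g k (drop_k N k a))"
    by (elim exE conjE) (rule that)
  have finX: "\<forall>k<N. finite (X k)" using assms(2) by blast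
  show ?Q
    unfolding quantum_process_correlation_iff_choi
    by (rule choi_correlation_of_process_function[OF assms(1) finX assms(3) pf f'])
qed

end
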